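(* Let $n\ge 2$ and let $\mathcal{F}$ be a convex family of dimension $k$ consisting of monomial proper maps from $B_n$ to $B_N$. Assume that, for every target dimension $M$, the bound $d\le c(n,M)$ holds for all monomial proper maps of degree $d$ from $B_n$ to $B_M$. Then, for all $f\in\mathcal{F}$, $$\deg(f)\le c(n,N-k).$$
   Context: $B_n$ is the open unit ball in $\mathbb{C}^n$ and $\|\cdot\|$ is the Euclidean norm. A monomial proper map is a proper holomorphic map between balls each of whose components is a constant times a monomial; its degree is its degree as a polynomial map. Two proper holomorphic maps $f,g$ from $B_n$ to possibly different balls are norm-equivalent if $\|f\|^2=\|g\|^2$ as functions on $B_n$; norm-equivalent maps are identified. A real-valued real-analytic function $R(z,\bar z)$ on $B_n$ belongs to $\mathcal{P}_\infty$ if $R=\|f\|^2$ for some holomorphic map $f$ on $B_n$ with values in a Hilbert space (here always finite-dimensional). Writing $R(z,\bar z)=\sum_{\alpha,\beta}c_{\alpha\beta}z^\alpha\bar z^\beta$, the Hermitian matrix $(c_{\alpha\beta})$ is called the underlying Hermitian form of $R$. Convex families: a zero-dimensional family is a single proper map. For $k\ge 1$, let $f_i:B_n\to B_{N_i}$, $1\le i\le k+1$, be proper holomorphic maps whose squared norms $\|f_i\|^2$ define linearly independent Hermitian forms. For $\lambda\in\mathbb{R}^k$ put $$R_\lambda=\sum_{j=1}^k\lambda_j\|f_j\|^2+\Big(1-\sum_{j=1}^k\lambda_j\Big)\|f_{k+1}\|^2,$$ and let $K\subset\mathbb{R}^k$ be the largest convex set such that $\lambda\in K$ implies $R_\lambda\in\mathcal{P}_\infty$.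 The $k$-dimensional convex family determined by these data consists of the proper maps $f$ (up to norm equivalence) with $\|f\|^2=R_\lambda$ for some $\lambda\in K$. It is a family of (monomial) maps from $B_n$ to $B_N$ if every member is, up to norm equivalence, a (monomial) map from $B_n$ to $B_N$. *)

theory Defs
  imports "HOL-Analysis.Analysis" "HOL-Analysis.Finite_Function_Topology"
begin

subsection \<open>Monomials and polynomials in several complex variables\<close>

definition monom_val :: "complex ^ 'n \<Rightarrow> ('n::finite \<Rightarrow> nat) \<Rightarrow> complex" where
  "monom_val z \<alpha> = (\<Prod>i\<in>UNIV. (z $ i) ^ \<alpha> i)"

text \<open>A polynomial is a finitely supported family of coefficients indexed by exponent vectors.\<close>

type_synonym 'n cpoly = "('n \<Rightarrow> nat) \<Rightarrow>\<^sub>0 complex"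

definition cpoly_val :: "'n::finite cpoly \<Rightarrow> complex ^ 'n \<Rightarrow> complex" where
  "cpoly_val p z = (\<Sum>\<alpha>\<in>Poly_Mapping.keys p. Poly_Mapping.lookup p \<alpha> * monom_val z \<alpha>)"

definition cpoly_degree :: "'n::finite cpoly \<Rightarrow> nat" where
  "cpoly_degree p = Max (insert 0 ((\<lambda>\<alpha>. \<Sum>i\<in>UNIV. \<alpha> i) ` Poly_Mapping.keys p))"

subsection \<open>Proper holomorphic maps between balls\<close>

text \<open>
  The source ball is \<open>ball 0 1\<close> in \<open>complex ^ 'n\<close>. Target dimensions vary within a statement, so
  \<open>\<complex>\<^sup>M\<close> is the set of functions \<open>nat \<Rightarrow> complex\<close> vanishing from index \<open>M\<close> on. On this set the
  product topology of \<open>nat \<Rightarrow> complex\<close> induces the Euclidean topology.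
\<close>

definition target_ball :: "nat \<Rightarrow> (nat \<Rightarrow> complex) set" where
  "target_ball M = {w. (\<forall>i\<ge>M. w i = 0) \<and> (\<Sum>i<M. (cmod (w i))\<^sup>2) < 1}"

text \<open>Only the values of a map on \<open>ball 0 1\<close> matter.\<close>

type_synonym 'n cmap = "complex ^ 'n \<Rightarrow> nat \<Rightarrow> complex"

text \<open>Complex Frechet differentiability at every point of an open set.\<close>

definition holomorphic_several :: "(complex ^ 'n::finite \<Rightarrow> complex) \<Rightarrow> (complex ^ 'n) set \<Rightarrow> bool" where
  "holomorphic_several g S \<longleftrightarrow>
     (\<forall>z\<in>S. \<exists>D. (g has_derivative D) (at z) \<and> (\<forall>a v. D (a *s v) = a * D v))"

definition holomorphic_map :: "nat \<Rightarrow> 'n::finite cmap \<Rightarrow> bool" where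
  "holomorphic_map M f \<longleftrightarrow> (\<forall>i<M. holomorphic_several (\<lambda>z. f z i) (ball 0 1))"

definition proper_holomorphic_map :: "nat \<Rightarrow> 'n::finite cmap \<Rightarrow> bool" where
  "proper_holomorphic_map M f \<longleftrightarrow>
     holomorphic_map M f \<and> f \<in> ball 0 1 \<rightarrow> target_ball M \<and>
     proper_map (top_of_set (ball 0 1)) (top_of_set (target_ball M)) f"

definition monomial_map :: "nat \<Rightarrow> 'n::finite cmap \<Rightarrow> bool" where
  "monomial_map M f \<longleftrightarrow> (\<forall>i<M. \<exists>a \<alpha>. \<forall>z\<in>ball 0 1. f z i = a * monom_val z \<alpha>)"

definition monomial_proper_map :: "nat \<Rightarrow> 'n::finite cmap \<Rightarrow> bool" where
  "monomial_proper_map M f \<longleftrightarrow> proper_holomorphic_map M f \<and> monomial_map M f"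

text \<open>
  A polynomial function on the ball has exactly one coefficient family; the degree of a polynomial
  map is meaningful only if all its components are polynomial.
\<close>

definition poly_of :: "(complex ^ 'n::finite \<Rightarrow> complex) \<Rightarrow> 'n cpoly" where
  "poly_of g = (THE p. \<forall>z\<in>ball 0 1. g z = cpoly_val p z)"

definition map_degree :: "nat \<Rightarrow> 'n::finite cmap \<Rightarrow> nat" where
  "map_degree M f = Max (insert 0 ((\<lambda>i. cpoly_degree (poly_of (\<lambda>z. f z i))) ` {..<M}))"

subsection \<open>Squared norms and Hermitian forms\<close>

definition sqnorm :: "nat \<Rightarrow> 'n::finite cmap \<Rightarrow> complex ^ 'n \<Rightarrow> real" where
  "sqnorm M f z = (\<Sum>i<M. (cmod (f z i))\<^sup>2)"

definition norm_equivalent :: "nat \<Rightarrow> 'n::finite cmap \<Rightarrow> nat \<Rightarrow> 'n cmap \<Rightarrow> bool" where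
  "norm_equivalent M f M' g \<longleftrightarrow> (\<forall>z\<in>ball 0 1. sqnorm M f z = sqnorm M' g z)"

definition in_P_infinity :: "(complex ^ 'n::finite \<Rightarrow> real) \<Rightarrow> bool" where
  "in_P_infinity R \<longleftrightarrow> (\<exists>M f. holomorphic_map M f \<and> (\<forall>z\<in>ball 0 1. R z = sqnorm M f z))"

text \<open>
  \<open>c\<close> is the matrix of Taylor coefficients of \<open>R\<close> at \<open>0\<close> in \<open>z\<close> and its conjugate. The expansion is
  required near \<open>0\<close> only, which determines \<open>c\<close>.
\<close>

definition has_hermitian_form ::
    "(complex ^ 'n::finite \<Rightarrow> real) \<Rightarrow> (('n \<Rightarrow> nat) \<Rightarrow> ('n \<Rightarrow> nat) \<Rightarrow> complex) \<Rightarrow> bool" where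
  "has_hermitian_form R c \<longleftrightarrow>
     (\<exists>r>0. \<forall>z\<in>ball 0 r.
        ((\<lambda>(\<alpha>, \<beta>). c \<alpha> \<beta> * monom_val z \<alpha> * cnj (monom_val z \<beta>)) has_sum complex_of_real (R z)) UNIV)"

text \<open>Hermitian matrices form a real vector space, so linear independence is over the reals.\<close>

definition independent_hermitian_forms :: "nat \<Rightarrow> (nat \<Rightarrow> complex ^ 'n::finite \<Rightarrow> real) \<Rightarrow> bool" where
  "independent_hermitian_forms m R \<longleftrightarrow>
     (\<exists>c. (\<forall>j<m. has_hermitian_form (R j) (c j)) \<and>
          (\<forall>a :: nat \<Rightarrow> real. (\<forall>\<alpha> \<beta>. (\<Sum>j<m. complex_of_real (a j) * c j \<alpha> \<beta>) = 0) \<longrightarrow> (\<forall>j<m. a j = 0)))"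

subsection \<open>Convex families\<close>

text \<open>
  The maps are indexed by \<open>0, \<dots>, k\<close> rather than \<open>1, \<dots>, k + 1\<close>. The parameter space \<open>\<real>\<^sup>k\<close> is the
  linear subspace of \<open>nat \<Rightarrow>\<^sub>0 real\<close> of the families supported in \<open>{..<k}\<close>, so that \<open>convex\<close> applies.
\<close>

definition param_space :: "nat \<Rightarrow> (nat \<Rightarrow>\<^sub>0 real) set" where
  "param_space k = {l. Poly_Mapping.keys l \<subseteq> {..<k}}"

definition family_norm ::
    "nat \<Rightarrow> (nat \<Rightarrow> nat) \<Rightarrow> (nat \<Rightarrow> 'n::finite cmap) \<Rightarrow> (nat \<Rightarrow>\<^sub>0 real) \<Rightarrow> complex ^ 'n \<Rightarrow> real" where
  "family_norm k Ns fs l z =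
     (\<Sum>j<k. Poly_Mapping.lookup l j * sqnorm (Ns j) (fs j) z) +
     (1 - (\<Sum>j<k. Poly_Mapping.lookup l j)) * sqnorm (Ns k) (fs k) z"

definition family_params :: "nat \<Rightarrow> (nat \<Rightarrow> nat) \<Rightarrow> (nat \<Rightarrow> 'n::finite cmap) \<Rightarrow> (nat \<Rightarrow>\<^sub>0 real) set" where
  "family_params k Ns fs =
     (GREATEST K. K \<subseteq> param_space k \<and> convex K \<and> (\<forall>l\<in>K. in_P_infinity (family_norm k Ns fs l)))"

text \<open>
  Norm-equivalent maps are identified by letting a family contain every map, together with its
  target dimension, that is norm-equivalent to a member.
\<close>

definition convex_family :: "nat \<Rightarrow> (nat \<times> 'n::finite cmap) set \<Rightarrow> bool" where
  "convex_family k \<F> \<longleftrightarrow>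
     (if k = 0 then
        \<exists>M f. proper_holomorphic_map M f \<and>
          \<F> = {(M', g). proper_holomorphic_map M' g \<and> norm_equivalent M' g M f}
      else
        \<exists>Ns fs. (\<forall>j\<le>k. proper_holomorphic_map (Ns j) (fs j)) \<and>
          independent_hermitian_forms (Suc k) (\<lambda>j. sqnorm (Ns j) (fs j)) \<and>
          \<F> = {(M, g). proper_holomorphic_map M g \<and>
                 (\<exists>l\<in>family_params k Ns fs. \<forall>z\<in>ball 0 1. sqnorm M g z = family_norm k Ns fs l z)})"

definition monomial_family :: "nat \<Rightarrow> (nat \<times> 'n::finite cmap) set \<Rightarrow> bool" where
  "monomial_family N \<F> \<longleftrightarrow>
     (\<forall>(M, f)\<in>\<F>. \<exists>g. monomial_proper_map N g \<and> norm_equivalent M f N g)"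

end

theory Submission
  imports Defs "HOL-Complex_Analysis.Conformal_Mappings"
begin

text \<open>
  The squared norm of a monomial map is a diagonal form
  \<open>\<Sum> p \<alpha> |z\<^sup>\<alpha>|\<^sup>2\<close> with nonnegative coefficients. A
  nonconstant monomial map is proper between balls exactly if its diagonal form equals
  \<open>1\<close> on the unit sphere, and the number of nonzero coefficients is the smallest target
  dimension in which the form is realized (\<open>monomial_proper_map_sphere_form\<close>,
  \<open>sphere_form_monomial_proper_map\<close>). The condition on the sphere is linear in the
  coefficients.

  A convex family of dimension \<open>k\<close> thus becomes the set of nonnegative points, apart
  from the constant form \<open>1\<close>, in an affine space of dimension \<open>k\<close> of
  coefficient vectors. Let \<open>T\<close> be the set of exponents that occur in its generators.
  The barycentre of the generators uses all of \<open>T\<close> and belongs to the family, so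
  \<open>T\<close> has at most \<open>N\<close> elements. At a vertex of the polyhedron at least
  \<open>k\<close> coefficients in \<open>T\<close> vanish, so a vertex other than the constant form
  is a monomial proper map into the ball of dimension \<open>N - k\<close>. For a member
  \<open>f\<close> of the family and an exponent \<open>\<alpha>0\<close> of top degree in its
  squared norm, some vertex has a positive coefficient at \<open>\<alpha>0\<close>
  (\<open>sparse_nonneg_point\<close>). The degree of that vertex bounds the degree of
  \<open>f\<close>.

  Two results translate between functions and coefficients. The form of a function that vanishes
  near \<open>0\<close> is zero (\<open>bimonom_independent\<close>,
  \<open>hermitian_form_of_zero\<close>), so the generators have linearly independent coefficient
  vectors. A member \<open>f\<close> is only norm-equivalent to a monomial map, but by polarization
  its components are linear combinations of the monomials in its squared norm
  (\<open>components_in_span_of_monomials\<close>), so its degree can be read off from the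
  coefficients.
\<close>

section \<open>Independence of monomials\<close>

text \<open>
  Pairs of exponent vectors index the terms \<open>z\<^sup>\<alpha> cnj (z\<^sup>\<beta>)\<close>,
  so that monomials, diagonal forms and general Hermitian forms are all covered by one independence
  result.
\<close>

definition bimonom :: "('n \<Rightarrow> nat) \<times> ('n \<Rightarrow> nat) \<Rightarrow> complex ^ 'n::finite \<Rightarrow> complex" where
  "bimonom \<mu> z = monom_val z (fst \<mu>) * cnj (monom_val z (snd \<mu>))"

definition scale_coord :: "'n \<Rightarrow> complex \<Rightarrow> complex ^ 'n \<Rightarrow> complex ^ 'n::finite" where
  "scale_coord i u z = (\<chi> j. (if j = i then u else 1) * z $ j)"

definition scale_factor :: "('n \<Rightarrow> nat) \<times> ('n \<Rightarrow> nat) \<Rightarrow> 'n \<Rightarrow> complex \<Rightarrow> complex" where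
  "scale_factor \<mu> i u = u ^ fst \<mu> i * cnj u ^ snd \<mu> i"

lemma monom_val_scale_coord: "monom_val (scale_coord i u z) \<alpha> = u ^ \<alpha> i * monom_val z \<alpha>"
proof -
  have "monom_val (scale_coord i u z) \<alpha> = (\<Prod>j\<in>UNIV. (if j = i then u ^ \<alpha> i else 1)) * monom_val z \<alpha>"
    unfolding monom_val_def scale_coord_def prod.distrib[symmetric]
    by (intro prod.cong) (auto simp: power_mult_distrib)
  then show ?thesis
    by (simp add: prod.delta)
qed

lemma bimonom_scale_coord: "bimonom \<mu> (scale_coord i u z) = scale_factor \<mu> i u * bimonom \<mu> z"
  by (simp add: bimonom_def scale_factor_def monom_val_scale_coord)

lemma norm_scale_coord_le: "cmod u \<le> 1 \<Longrightarrow> norm (scale_coord i u z) \<le> norm z"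
  by (rule norm_le_componentwise_cart) (auto simp: scale_coord_def norm_mult mult_left_le_one_le)

text \<open>
  With \<open>e = a - c\<close>, the rotation by \<open>\<pi> / (2 e)\<close> maps the two terms to
  \<open>\<i> m\<close> and \<open>- \<i> m\<close> for a common \<open>m \<noteq> 0\<close>.
\<close>

lemma rotation_separates:
  assumes "c < a" "a + b = c + (d :: nat)"
  shows "\<exists>u. cmod u = 1 \<and> u ^ a * cnj u ^ b \<noteq> u ^ c * cnj u ^ d"
proof -
  obtain e where e: "a = c + e" "d = b + e" "e > 0"
    using assms by (metis add.assoc add.commute add_left_cancel less_imp_add_positive)
  define u where "u = cis (pi / 2 / real e)"
  have ue: "u ^ e = \<i>"
  proof -
    have *: "real e * (pi / 2 / real e) = pi / 2"
      using e(3) by simp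
    then show ?thesis
      by (simp only: u_def Complex.DeMoivre * cis_pi_half)
  qed
  then have "cnj u ^ e = - \<i>"
    by (metis complex_cnj_i complex_cnj_power)
  then have "u ^ a * cnj u ^ b - u ^ c * cnj u ^ d = u ^ c * cnj u ^ b * (2 * \<i>)"
    by (simp add: e power_add ue algebra_simps)
  moreover have "u \<noteq> 0"
    by (simp add: u_def)
  ultimately show ?thesis
    by (intro exI[of _ u]) (auto simp: u_def)
qed

text \<open>
  The factor \<open>u = 1 / 2\<close> detects the total exponent of a coordinate; for equal totals a
  rotation detects how it is distributed between \<open>z\<close> and its conjugate.
\<close>

lemma scale_factor_separates:
  assumes "\<mu> \<noteq> \<nu>"
  obtains i u where "cmod u \<le> 1" "scale_factor \<mu> i u \<noteq> scale_factor \<nu> i u"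
proof -
  obtain i where i: "fst \<mu> i \<noteq> fst \<nu> i \<or> snd \<mu> i \<noteq> snd \<nu> i"
    using assms by (meson ext prod_eqI)
  have "\<exists>u. cmod u \<le> 1 \<and> scale_factor \<mu> i u \<noteq> scale_factor \<nu> i u"
  proof (cases "fst \<mu> i + snd \<mu> i = fst \<nu> i + snd \<nu> i")
    case False
    have "scale_factor \<mu>' i (1 / 2) = (1 / 2) ^ (fst \<mu>' i + snd \<mu>' i)" for \<mu>' :: "('a \<Rightarrow> nat) \<times> ('a \<Rightarrow> nat)"
      by (simp add: scale_factor_def power_add)
    moreover have "(1 / 2 :: complex) ^ m \<noteq> (1 / 2) ^ n" if "m \<noteq> n" for m n
    proof -
      have "(1 / 2 :: real) ^ m \<noteq> (1 / 2) ^ n"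
        using that by (simp add: power_inject_exp')
      then show ?thesis
        by (metis norm_power norm_divide norm_one norm_numeral)
    qed
    ultimately show ?thesis
      using False by (intro exI[of _ "1 / 2"]) (simp add: norm_divide)
  next
    case True
    then consider "fst \<nu> i < fst \<mu> i" | "fst \<mu> i < fst \<nu> i"
      using i by linarith
    then show ?thesis
    proof cases
      case 1
      then show ?thesis
        using rotation_separates[OF 1 True] unfolding scale_factor_def by (metis order_refl)
    next
      case 2
      then show ?thesis
        using rotation_separates[OF 2 True[symmetric]] unfolding scale_factor_def by (metis order_refl)
    qed
  qed
  with that show ?thesis by blast
qed

text \<open>
  The finite combinations of point evaluations, with their coefficients, as lists; they stand in for
  the linear functionals in a dual basis.
\<close>

definition point_eval :: "(complex \<times> 'a) list \<Rightarrow> ('a \<Rightarrow> complex) \<Rightarrow> complex" where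
  "point_eval xs h = (\<Sum>x\<leftarrow>xs. fst x * h (snd x))"

lemma point_eval_sum: "point_eval xs (\<lambda>z. \<Sum>a\<in>A. f a z) = (\<Sum>a\<in>A. point_eval xs (f a))"
  by (induction xs) (auto simp: point_eval_def sum.distrib sum_distrib_left)

lemma point_eval_cmult: "point_eval xs (\<lambda>z. c * f z) = c * point_eval xs f"
  by (induction xs) (auto simp: point_eval_def algebra_simps)

lemma point_eval_cong: "(\<And>x. x \<in> set xs \<Longrightarrow> f (snd x) = g (snd x)) \<Longrightarrow> point_eval xs f = point_eval xs g"
  unfolding point_eval_def by (intro arg_cong[of _ _ sum_list] map_cong) auto

lemma point_eval_zero: "point_eval xs (\<lambda>_. 0) = 0"
  by (induction xs) (auto simp: point_eval_def)

text \<open>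
  A member \<open>\<nu>\<close> of \<open>A\<close> is killed by composing with the scaling of one
  coordinate and subtracting \<open>scale_factor \<nu>\<close> times the unscaled functional. This
  multiplies the value at \<open>\<mu>\<close> by a nonzero number as soon as the scaling separates
  \<open>\<mu>\<close> from \<open>\<nu>\<close>, and it keeps the values already killed. Starting
  from one evaluation off the coordinate hyperplanes, all members of \<open>A\<close> other than
  \<open>\<mu>\<close> are removed in turn.
\<close>

lemma dual_point_eval:
  fixes \<mu> :: "('n::finite \<Rightarrow> nat) \<times> ('n \<Rightarrow> nat)"
  assumes "finite A" "r > 0"
  obtains xs where "snd ` set xs \<subseteq> ball 0 r"
    "\<And>\<nu>. \<nu> \<in> insert \<mu> A \<Longrightarrow> point_eval xs (bimonom \<nu>) = (if \<nu> = \<mu> then 1 else 0)"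
proof -
  have "\<exists>xs. snd ` set xs \<subseteq> ball 0 r \<and> point_eval xs (bimonom \<mu>) = 1 \<and>
          (\<forall>\<nu>\<in>A - {\<mu>}. point_eval xs (bimonom \<nu>) = 0)"
    using assms(1)
  proof induction
    case empty
    define z where "z = (\<chi> i::'n. complex_of_real (r / (2 * real CARD('n))))"
    have "norm z \<le> (\<Sum>i\<in>(UNIV::'n set). norm (z $ i))"
      unfolding norm_vec_def by (rule L2_set_le_sum) auto
    also have "\<dots> = r / 2"
      using assms(2) by (simp add: z_def norm_divide norm_mult)
    finally have "z \<in> ball 0 r"
      using assms(2) by simp
    moreover have "bimonom \<mu> z \<noteq> 0"
      using assms(2) by (simp add: z_def bimonom_def monom_val_def)
    ultimately show ?case
      by (intro exI[of _ "[(1 / bimonom \<mu> z, z)]"]) (simp add: point_eval_def)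
  next
    case (insert \<nu> A)
    then obtain xs where xs: "snd ` set xs \<subseteq> ball 0 r" "point_eval xs (bimonom \<mu>) = 1"
      "\<forall>\<nu>\<in>A - {\<mu>}. point_eval xs (bimonom \<nu>) = 0"
      by blast
    show ?case
    proof (cases "\<nu> = \<mu>")
      case True
      with xs show ?thesis by (intro exI[of _ xs]) auto
    next
      case False
      then obtain i u where u: "cmod u \<le> 1" "scale_factor \<mu> i u \<noteq> scale_factor \<nu> i u"
        by (metis scale_factor_separates)
      define s where "s = 1 / (scale_factor \<mu> i u - scale_factor \<nu> i u)"
      define ys where "ys = map (\<lambda>(\<kappa>, w). (s * \<kappa>, scale_coord i u w)) xs @
          map (\<lambda>(\<kappa>, w). (- s * scale_factor \<nu> i u * \<kappa>, w)) xs"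
      have ys: "point_eval ys (bimonom \<rho>) =
          s * (scale_factor \<rho> i u - scale_factor \<nu> i u) * point_eval xs (bimonom \<rho>)" for \<rho>
      proof -
        have "point_eval (map (\<lambda>(\<kappa>, w). (s * \<kappa>, scale_coord i u w)) xs) (bimonom \<rho>) =
            s * scale_factor \<rho> i u * point_eval xs (bimonom \<rho>)"
          by (induction xs) (auto simp: point_eval_def bimonom_scale_coord algebra_simps)
        moreover have "point_eval (map (\<lambda>(\<kappa>, w). (- s * scale_factor \<nu> i u * \<kappa>, w)) xs) (bimonom \<rho>) =
            - s * scale_factor \<nu> i u * point_eval xs (bimonom \<rho>)"
          by (induction xs) (auto simp: point_eval_def algebra_simps)
        ultimately show ?thesis
          by (simp add: ys_def point_eval_def algebra_simps)
      qed
      have "norm (scale_coord i u w) < r" if "norm w < r" for w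
        using norm_scale_coord_le[OF u(1), of i w] that by linarith
      then have "snd ` set ys \<subseteq> ball 0 r"
        using xs(1) by (fastforce simp: ys_def)
      moreover have "point_eval ys (bimonom \<mu>) = 1"
        using u(2) xs(2) by (simp add: ys s_def)
      moreover have "\<forall>\<rho>\<in>insert \<nu> A - {\<mu>}. point_eval ys (bimonom \<rho>) = 0"
        using xs(3) by (auto simp: ys)
      ultimately show ?thesis by blast
    qed
  qed
  then obtain xs where "snd ` set xs \<subseteq> ball 0 r" "point_eval xs (bimonom \<mu>) = 1"
    "\<forall>\<nu>\<in>A - {\<mu>}. point_eval xs (bimonom \<nu>) = 0" by blast
  then show ?thesis
    by (intro that[of xs]) auto
qed

lemma bimonom_independent:
  assumes "finite A" "r > 0" and zero: "\<And>z. z \<in> ball 0 r \<Longrightarrow> (\<Sum>\<nu>\<in>A. c \<nu> * bimonom \<nu> z) = 0"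
    and "\<mu> \<in> A"
  shows "c \<mu> = 0"
proof -
  obtain xs where xs: "snd ` set xs \<subseteq> ball 0 r"
    "\<And>\<nu>. \<nu> \<in> insert \<mu> A \<Longrightarrow> point_eval xs (bimonom \<nu>) = (if \<nu> = \<mu> then 1 else 0)"
    using dual_point_eval[OF assms(1,2)] by blast
  have "0 = point_eval xs (\<lambda>z. \<Sum>\<nu>\<in>A. c \<nu> * bimonom \<nu> z)"
    using xs(1) by (subst point_eval_cong[of _ _ "\<lambda>_. 0"]) (auto simp: point_eval_zero intro!: zero)
  also have "\<dots> = (\<Sum>\<nu>\<in>A. c \<nu> * (if \<nu> = \<mu> then 1 else 0))"
    unfolding point_eval_sum point_eval_cmult using xs(2) by (intro sum.cong) auto
  also have "\<dots> = c \<mu>"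
    using assms(1,4) by (simp add: sum.delta if_distrib cong: if_cong)
  finally show ?thesis by simp
qed

lemma powser_zero_imp_coeffs_zero:
  fixes a :: "nat \<Rightarrow> real"
  assumes "r > 0" and sm: "\<And>t. \<bar>t\<bar> < r \<Longrightarrow> (\<lambda>n. a n * t ^ n) sums 0"
  shows "a m = 0"
proof (cases "m = 0")
  case True
  have "(\<lambda>n. a n * 0 ^ n) sums 0"
    using sm[of 0] assms(1) by simp
  then show ?thesis
    using True powser_sums_zero_iff by auto
next
  case False
  show ?thesis
  proof (rule ccontr)
    assume "a m \<noteq> 0"
    then obtain s where s: "0 < s" "\<And>z::real. z \<in> cball 0 s - {0} \<Longrightarrow> (0::real) \<noteq> 0"
      using powser_0_nonzero[of r 0 a "\<lambda>_. 0" m] assms False by (auto simp: real_norm_def)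
    then show False
      using s(2)[of s] by (simp add: dist_real_def)
  qed
qed

lemma finite_multidegree_le: "finite {\<alpha> :: 'n::finite \<Rightarrow> nat. sum \<alpha> UNIV \<le> d}"
proof (rule finite_subset)
  show "{\<alpha> :: 'n \<Rightarrow> nat. sum \<alpha> UNIV \<le> d} \<subseteq> PiE UNIV (\<lambda>_. {..d})"
  proof
    fix \<alpha> :: "'n \<Rightarrow> nat" assume "\<alpha> \<in> {\<alpha>. sum \<alpha> UNIV \<le> d}"
    moreover have "\<alpha> i \<le> sum \<alpha> UNIV" for i
      by (rule member_le_sum) auto
    ultimately have "\<alpha> i \<le> d" for i
      by (metis le_trans mem_Collect_eq)
    then show "\<alpha> \<in> PiE UNIV (\<lambda>_. {..d})" by auto
  qed
qed (auto intro: finite_PiE)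

lemma monom_val_scaleR: "monom_val (t *\<^sub>R z) \<alpha> = of_real t ^ sum \<alpha> UNIV * monom_val z \<alpha>"
  unfolding monom_val_def
  by (simp add: power_sum prod.distrib[symmetric] scaleR_conv_of_real[where 'a = complex] power_mult_distrib)

text \<open>
  On the line through \<open>0\<close> and \<open>z\<close>, the form is a power series in the real
  parameter. Its coefficients are the sums over the bimonomials of fixed total degree. They are
  finite sums that vanish for all small \<open>z\<close>, so the independence of finitely many
  bimonomials applies.
\<close>

lemma hermitian_form_of_zero:
  fixes c :: "('n::finite \<Rightarrow> nat) \<Rightarrow> ('n \<Rightarrow> nat) \<Rightarrow> complex"
  assumes "has_hermitian_form R c" and "s > 0" and R0: "\<And>z. z \<in> ball 0 s \<Longrightarrow> R z = 0"
  shows "c \<alpha> \<beta> = 0"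
proof -
  define deg2 where "deg2 \<mu> = sum (fst \<mu>) UNIV + sum (snd \<mu>) UNIV" for \<mu> :: "('n \<Rightarrow> nat) \<times> ('n \<Rightarrow> nat)"
  define A where "A d = {\<mu>. deg2 \<mu> = d}" for d
  define c' where "c' \<mu> = c (fst \<mu>) (snd \<mu>)" for \<mu>
  have fin: "finite (A d)" for d
    by (rule finite_subset[OF _ finite_cartesian_product[OF finite_multidegree_le[of d] finite_multidegree_le[of d]]])
      (auto simp: A_def deg2_def)
  obtain r' where r': "r' > 0"
    "\<And>z. z \<in> ball 0 r' \<Longrightarrow> ((\<lambda>\<mu>. c' \<mu> * bimonom \<mu> z) has_sum complex_of_real (R z)) UNIV"
    using assms(1) unfolding has_hermitian_form_def c'_def bimonom_def
    by (auto simp: case_prod_unfold mult.assoc)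
  define r where "r = min r' s"
  have r: "r > 0"
    using r'(1) assms(2) by (simp add: r_def)
  have sum0: "((\<lambda>\<mu>. c' \<mu> * bimonom \<mu> z) has_sum 0) UNIV" if "z \<in> ball 0 r" for z
    using r'(2)[of z] R0[of z] that by (simp add: r_def)
  define P where "P d z = (\<Sum>\<mu>\<in>A d. c' \<mu> * bimonom \<mu> z)" for d z
  have series: "(\<lambda>d. of_real t ^ d * P d z) sums 0" if "norm (t *\<^sub>R z) < r" for t :: real and z
  proof -
    have eq: "c' \<mu> * bimonom \<mu> (t *\<^sub>R z) = of_real t ^ deg2 \<mu> * (c' \<mu> * bimonom \<mu> z)" for \<mu>
      by (simp add: bimonom_def monom_val_scaleR deg2_def power_add)
    have "((\<lambda>\<mu>. of_real t ^ deg2 \<mu> * (c' \<mu> * bimonom \<mu> z)) has_sum 0) UNIV"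
      using sum0[of "t *\<^sub>R z"] that unfolding eq by simp
    moreover have "bij_betw snd (Sigma UNIV A) UNIV"
      by (rule bij_betwI[where g = "\<lambda>\<mu>. (deg2 \<mu>, \<mu>)"]) (auto simp: A_def)
    ultimately have "((\<lambda>x. of_real t ^ deg2 (snd x) * (c' (snd x) * bimonom (snd x) z)) has_sum 0) (Sigma UNIV A)"
      by (simp add: has_sum_reindex_bij_betw[of snd "Sigma UNIV A" UNIV "\<lambda>\<mu>. of_real t ^ deg2 \<mu> * (c' \<mu> * bimonom \<mu> z)"])
    moreover have "((\<lambda>\<mu>. of_real t ^ deg2 (snd (d, \<mu>)) * (c' (snd (d, \<mu>)) * bimonom (snd (d, \<mu>)) z))
        has_sum (of_real t ^ d * P d z)) (A d)" for d
      by (rule has_sum_finiteI[OF fin]) (auto simp: P_def sum_distrib_left A_def)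
    ultimately have "((\<lambda>d. of_real t ^ d * P d z) has_sum 0) UNIV"
      by (rule has_sum_Sigma')
    then show ?thesis
      by (rule has_sum_imp_sums)
  qed
  have P0: "P d z = 0" if "z \<in> ball 0 r" for d z
  proof -
    have small: "norm (t *\<^sub>R z) < r" if "\<bar>t\<bar> < 1" for t
      using \<open>z \<in> ball 0 r\<close> that mult_left_le_one_le[of "norm z" "\<bar>t\<bar>"] by auto
    have "Re (of_real t ^ n * w) = Re w * t ^ n" "Im (of_real t ^ n * w) = Im w * t ^ n" for t n w
      by (simp_all flip: of_real_power)
    then have "(\<lambda>n. Re (P n z) * t ^ n) sums 0" "(\<lambda>n. Im (P n z) * t ^ n) sums 0" if "\<bar>t\<bar> < 1" for t
      using sums_Re[OF series[OF small[OF that]]] sums_Im[OF series[OF small[OF that]]] by (simp_all add: mult.commute)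
    then have "Re (P d z) = 0" "Im (P d z) = 0"
      using powser_zero_imp_coeffs_zero[of 1 "\<lambda>n. Re (P n z)"] powser_zero_imp_coeffs_zero[of 1 "\<lambda>n. Im (P n z)"]
      by simp_all
    then show ?thesis by (simp add: complex_eq_iff)
  qed
  have "c' (\<alpha>, \<beta>) = 0"
    by (rule bimonom_independent[OF fin[of "deg2 (\<alpha>, \<beta>)"] r]) (use P0 in \<open>auto simp: P_def A_def\<close>)
  then show ?thesis by (simp add: c'_def)
qed

section \<open>Polynomials and diagonal Hermitian forms\<close>

lemma cpoly_val_superset:
  assumes "finite T" "Poly_Mapping.keys P \<subseteq> T"
  shows "cpoly_val P z = (\<Sum>\<alpha>\<in>T. Poly_Mapping.lookup P \<alpha> * monom_val z \<alpha>)"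
  unfolding cpoly_val_def
  by (rule sum.mono_neutral_left) (use assms in \<open>auto simp: in_keys_iff\<close>)

lemma poly_of_eqI:
  assumes "\<And>z. z \<in> ball 0 1 \<Longrightarrow> g z = cpoly_val P z"
  shows "poly_of g = P"
  unfolding poly_of_def
proof (rule the_equality)
  fix Q assume Q: "\<forall>z\<in>ball 0 1. g z = cpoly_val Q z"
  define T where "T = Poly_Mapping.keys P \<union> Poly_Mapping.keys Q"
  define A where "A = (\<lambda>\<alpha>. (\<alpha>, \<lambda>_::'a. 0::nat)) ` T"
  define c where "c \<mu> = Poly_Mapping.lookup Q (fst \<mu>) - Poly_Mapping.lookup P (fst \<mu>)" for \<mu> :: "('a \<Rightarrow> nat) \<times> ('a \<Rightarrow> nat)"
  have fin: "finite T" "finite A" by (auto simp: T_def A_def)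
  have "c (\<alpha>, \<lambda>_. 0) = 0" if "\<alpha> \<in> T" for \<alpha>
  proof (rule bimonom_independent[OF fin(2), of 1])
    fix z :: "complex ^ 'a" assume z: "z \<in> ball 0 1"
    have "(\<Sum>\<mu>\<in>A. c \<mu> * bimonom \<mu> z) = (\<Sum>\<alpha>\<in>T. c (\<alpha>, \<lambda>_. 0) * monom_val z \<alpha>)"
      unfolding A_def by (subst sum.reindex) (auto simp: inj_on_def bimonom_def monom_val_def)
    also have "\<dots> = cpoly_val Q z - cpoly_val P z"
      using fin(1) by (subst (1 2) cpoly_val_superset[of T])
        (auto simp: c_def T_def sum_subtractf left_diff_distrib)
    finally show "(\<Sum>\<mu>\<in>A. c \<mu> * bimonom \<mu> z) = 0"
      using Q assms z by simp
  qed (use that in \<open>auto simp: A_def\<close>)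
  then have "Poly_Mapping.lookup Q \<alpha> = Poly_Mapping.lookup P \<alpha>" for \<alpha>
    by (cases "\<alpha> \<in> T") (auto simp: c_def T_def in_keys_iff)
  then show "Q = P" by (rule poly_mapping_eqI)
qed (use assms in auto)

definition diag_form :: "(('n::finite \<Rightarrow> nat) \<Rightarrow> real) \<Rightarrow> complex ^ 'n \<Rightarrow> real" where
  "diag_form p z = (\<Sum>\<alpha> | p \<alpha> \<noteq> 0. p \<alpha> * (cmod (monom_val z \<alpha>))\<^sup>2)"

lemma diag_form_superset:
  assumes "finite T" "\<And>\<alpha>. \<alpha> \<notin> T \<Longrightarrow> p \<alpha> = 0"
  shows "diag_form p z = (\<Sum>\<alpha>\<in>T. p \<alpha> * (cmod (monom_val z \<alpha>))\<^sup>2)"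
  unfolding diag_form_def by (rule sum.mono_neutral_left) (use assms in auto)

lemma diag_form_inject:
  assumes "finite {\<alpha>. p \<alpha> \<noteq> 0}" "finite {\<alpha>. q \<alpha> \<noteq> 0}"
    and eq: "\<And>z. z \<in> ball 0 1 \<Longrightarrow> diag_form p z = diag_form q z"
  shows "p = q"
proof
  fix \<alpha>
  define T where "T = {\<alpha>. p \<alpha> \<noteq> 0} \<union> {\<alpha>. q \<alpha> \<noteq> 0}"
  define A where "A = (\<lambda>\<alpha>. (\<alpha>, \<alpha>)) ` T"
  define c where "c \<mu> = complex_of_real (p (fst \<mu>) - q (fst \<mu>))" for \<mu> :: "('a \<Rightarrow> nat) \<times> ('a \<Rightarrow> nat)"
  have fin: "finite T" "finite A" using assms by (auto simp: T_def A_def)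
  have "c (\<alpha>, \<alpha>) = 0" if "\<alpha> \<in> T"
  proof (rule bimonom_independent[OF fin(2), of 1])
    fix z :: "complex ^ 'a" assume z: "z \<in> ball 0 1"
    have "(\<Sum>\<mu>\<in>A. c \<mu> * bimonom \<mu> z) = (\<Sum>\<alpha>\<in>T. c (\<alpha>, \<alpha>) * (monom_val z \<alpha> * cnj (monom_val z \<alpha>)))"
      unfolding A_def by (subst sum.reindex) (auto simp: inj_on_def bimonom_def)
    also have "\<dots> = complex_of_real (\<Sum>\<alpha>\<in>T. (p \<alpha> - q \<alpha>) * (cmod (monom_val z \<alpha>))\<^sup>2)"
      by (simp add: c_def flip: complex_norm_square)
    also have "(\<Sum>\<alpha>\<in>T. (p \<alpha> - q \<alpha>) * (cmod (monom_val z \<alpha>))\<^sup>2) = diag_form p z - diag_form q z"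
      using fin(1) by (subst (1 2) diag_form_superset[of T])
        (auto simp: T_def sum_subtractf left_diff_distrib)
    finally show "(\<Sum>\<mu>\<in>A. c \<mu> * bimonom \<mu> z) = 0"
      using eq[OF z] by simp
  qed (use that in \<open>auto simp: A_def\<close>)
  then show "p \<alpha> = q \<alpha>"
    by (cases "\<alpha> \<in> T") (auto simp: c_def T_def)
qed

lemma diag_form_scaleR:
  "diag_form p (t *\<^sub>R z) = (\<Sum>\<alpha> | p \<alpha> \<noteq> 0. (t\<^sup>2) ^ sum \<alpha> UNIV * (p \<alpha> * (cmod (monom_val z \<alpha>))\<^sup>2))"
proof -
  have "(\<bar>t\<bar> ^ n)\<^sup>2 = (t\<^sup>2) ^ n" for n
    by (metis power2_abs power_mult mult.commute)
  then show ?thesis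
    unfolding diag_form_def
    by (intro sum.cong) (auto simp: monom_val_scaleR norm_mult norm_power power_mult_distrib mult.left_commute)
qed

lemma continuous_monom_val [continuous_intros]: "continuous_on S (\<lambda>z. monom_val z \<alpha>)"
  unfolding monom_val_def by (intro continuous_intros)

section \<open>Squared norms of monomial proper maps\<close>

text \<open>
  The coefficient families of the squared norms of monomial proper maps. The last condition excludes
  the constant form \<open>1\<close>, whose monomial map sends the whole ball into the unit sphere.
\<close>

definition sphere_form :: "(('n::finite \<Rightarrow> nat) \<Rightarrow> real) \<Rightarrow> bool" where
  "sphere_form p \<longleftrightarrow> finite {\<alpha>. p \<alpha> \<noteq> 0} \<and> (\<forall>\<alpha>. p \<alpha> \<ge> 0) \<and>
     (\<forall>z. norm z = 1 \<longrightarrow> diag_form p z = 1) \<and> (\<exists>\<alpha>. \<alpha> \<noteq> (\<lambda>_. 0) \<and> p \<alpha> \<noteq> 0)"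

text \<open>
  At a point off the coordinate hyperplanes, every nonzero coefficient contributes to a diagonal
  form.
\<close>

lemma generic_unit_vector:
  obtains u :: "complex ^ 'n::finite" where "norm u = 1" "\<And>\<alpha>. monom_val u \<alpha> \<noteq> 0"
proof
  define w :: "complex ^ 'n" where "w = (\<chi> i. 1)"
  have "w \<noteq> 0" by (simp add: w_def vec_eq_iff)
  then show "norm (w /\<^sub>R norm w) = 1" by simp
  show "monom_val (w /\<^sub>R norm w) \<alpha> \<noteq> 0" for \<alpha>
    using \<open>w \<noteq> 0\<close> by (simp add: monom_val_scaleR) (simp add: monom_val_def w_def)
qed

lemma diag_form_constant:
  assumes "\<And>\<alpha>. \<alpha> \<noteq> (\<lambda>_. 0) \<Longrightarrow> p \<alpha> * (cmod (monom_val z \<alpha>))\<^sup>2 = 0" "finite {\<alpha>. p \<alpha> \<noteq> 0}"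
  shows "diag_form p z = p (\<lambda>_. 0)"
proof -
  have "diag_form p z = (\<Sum>\<alpha>\<in>insert (\<lambda>_. 0) {\<alpha>. p \<alpha> \<noteq> 0}. p \<alpha> * (cmod (monom_val z \<alpha>))\<^sup>2)"
    using assms(2) by (intro diag_form_superset) auto
  also have "\<dots> = (\<Sum>\<alpha>\<in>{\<lambda>_. 0}. p \<alpha> * (cmod (monom_val z \<alpha>))\<^sup>2)"
    using assms by (intro sum.mono_neutral_right) auto
  also have "\<dots> = p (\<lambda>_. 0)"
    by (simp add: monom_val_def)
  finally show ?thesis .
qed

text \<open>
  On a ray from the origin, each term of positive degree increases strictly unless it vanishes
  there. Not all of them vanish: the constant coefficient is less than \<open>1\<close>, by
  evaluation at a generic point of the sphere, while the sum at the end of the ray is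
  \<open>1\<close>.
\<close>

lemma sphere_form_less_1:
  assumes p: "sphere_form p" and z: "norm z < 1"
  shows "diag_form p z < 1"
proof -
  have fin: "finite {\<alpha>. p \<alpha> \<noteq> 0}" and nonneg: "p \<alpha> \<ge> 0" and sphere: "norm u = 1 \<Longrightarrow> diag_form p u = 1" for \<alpha> u
    using p by (auto simp: sphere_form_def)
  obtain \<alpha>1 where \<alpha>1: "\<alpha>1 \<noteq> (\<lambda>_. 0)" "p \<alpha>1 \<noteq> 0"
    using p by (auto simp: sphere_form_def)
  obtain g :: "complex ^ 'a" where g: "norm g = 1" "\<And>\<alpha>. monom_val g \<alpha> \<noteq> 0"
    using generic_unit_vector by blast
  \<comment> \<open>At the generic point the term of \<open>\<alpha>1\<close> is positive, which leaves less than \<open>1\<close> for the constant term.\<close>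
  have p0: "p (\<lambda>_. 0) < 1"
  proof -
    define T where "T = insert (\<lambda>_. 0) {\<alpha>. p \<alpha> \<noteq> 0}"
    have "p (\<lambda>_. 0) + p \<alpha>1 * (cmod (monom_val g \<alpha>1))\<^sup>2 = (\<Sum>\<alpha>\<in>{\<lambda>_. 0, \<alpha>1}. p \<alpha> * (cmod (monom_val g \<alpha>))\<^sup>2)"
      using \<alpha>1 by (simp add: monom_val_def)
    also have "\<dots> \<le> (\<Sum>\<alpha>\<in>T. p \<alpha> * (cmod (monom_val g \<alpha>))\<^sup>2)"
      using fin \<alpha>1 nonneg by (intro sum_mono2) (auto simp: T_def)
    also have "\<dots> = diag_form p g"
      using fin by (intro diag_form_superset[symmetric]) (auto simp: T_def)
    also have "\<dots> = 1" using sphere g by simp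
    finally show ?thesis
      using \<alpha>1(2) nonneg[of \<alpha>1] g(2)[of \<alpha>1] by (smt (verit) mult_pos_pos zero_less_power zero_less_norm_iff)
  qed
  obtain u where u: "norm u = 1" "z = norm z *\<^sub>R u"
  proof (cases "z = 0")
    case True
    then show ?thesis using that[of g] g by simp
  next
    case False
    then show ?thesis using that[of "z /\<^sub>R norm z"] by simp
  qed
  define t where "t = (norm z)\<^sup>2"
  have t: "0 \<le> t" "t < 1" using z by (auto simp: t_def power_less_one_iff abs_square_less_1)
  define b where "b \<alpha> = p \<alpha> * (cmod (monom_val u \<alpha>))\<^sup>2" for \<alpha>
  have b0: "b \<alpha> \<ge> 0" for \<alpha> using nonneg by (simp add: b_def)
  have zt: "diag_form p z = (\<Sum>\<alpha> | p \<alpha> \<noteq> 0. t ^ sum \<alpha> UNIV * b \<alpha>)"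
    by (subst u(2)) (simp add: diag_form_scaleR b_def t_def)
  have u1: "(\<Sum>\<alpha> | p \<alpha> \<noteq> 0. b \<alpha>) = 1"
    using sphere[OF u(1)] by (simp add: diag_form_def b_def)
  have "\<exists>\<alpha>. \<alpha> \<noteq> (\<lambda>_. 0) \<and> b \<alpha> \<noteq> 0"
    using diag_form_constant[OF _ fin, of u] sphere[OF u(1)] p0 by (force simp: b_def)
  then obtain \<alpha> where \<alpha>: "\<alpha> \<noteq> (\<lambda>_. 0)" "b \<alpha> \<noteq> 0" by blast
  have "(\<Sum>\<alpha> | p \<alpha> \<noteq> 0. t ^ sum \<alpha> UNIV * b \<alpha>) < (\<Sum>\<alpha> | p \<alpha> \<noteq> 0. b \<alpha>)"
  proof (rule sum_strict_mono_ex1[OF fin])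
    show "\<forall>\<alpha>\<in>{\<alpha>. p \<alpha> \<noteq> 0}. t ^ sum \<alpha> UNIV * b \<alpha> \<le> b \<alpha>"
      using t b0 by (auto intro!: mult_left_le_one_le power_le_one)
    have "sum \<alpha> UNIV \<noteq> 0" using \<alpha>(1) by (auto simp: fun_eq_iff)
    then have "t ^ sum \<alpha> UNIV < 1" using t power_less_one_iff[of t "sum \<alpha> UNIV"] by blast
    then have "t ^ sum \<alpha> UNIV * b \<alpha> < b \<alpha>"
      using \<alpha>(2) b0[of \<alpha>] by (simp add: mult_less_cancel_right2 less_le)
    moreover have "p \<alpha> \<noteq> 0" using \<alpha>(2) by (auto simp: b_def)
    ultimately show "\<exists>\<alpha>\<in>{\<alpha>. p \<alpha> \<noteq> 0}. t ^ sum \<alpha> UNIV * b \<alpha> < b \<alpha>" by blast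
  qed
  with zt u1 show ?thesis by simp
qed

text \<open>
  If \<open>G u\<close> were in the open target ball, then the images of a sequence tending radially
  to \<open>u\<close> would form, together with \<open>G u\<close>, a compact subset of that ball.
  Its preimage would be compact in the source ball, although it contains a sequence that tends to
  the boundary point \<open>u\<close>.
\<close>

lemma proper_extension_sqnorm_ge_1:
  fixes f G :: "'n::finite cmap"
  assumes proper: "proper_holomorphic_map N f"
    and cont: "continuous_on UNIV G" and G0: "\<And>z i. i \<ge> N \<Longrightarrow> G z i = 0"
    and fG: "\<And>z. z \<in> ball 0 1 \<Longrightarrow> f z = G z" and u: "norm u = 1"
  shows "sqnorm N G u \<ge> 1"
proof (rule ccontr)
  assume "\<not> sqnorm N G u \<ge> 1"
  then have Gu: "G u \<in> target_ball N"
    using G0 by (auto simp: target_ball_def sqnorm_def)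
  define s where "s n = (1 - inverse (real (Suc (Suc n)))) *\<^sub>R u" for n
  have s_lim: "s \<longlonglongrightarrow> u"
  proof -
    have "(\<lambda>n. inverse (real (Suc (Suc n)))) \<longlonglongrightarrow> 0"
      by (rule LIMSEQ_Suc[OF LIMSEQ_inverse_real_of_nat])
    then have "(\<lambda>n. (1 - inverse (real (Suc (Suc n)))) *\<^sub>R u) \<longlonglongrightarrow> (1 - 0) *\<^sub>R u"
      by (intro tendsto_intros)
    then show ?thesis by (simp add: s_def[abs_def])
  qed
  have s_ball: "s n \<in> ball 0 1" for n
  proof -
    have "inverse (real (Suc (Suc n))) \<le> 1" "inverse (real (Suc (Suc n))) > 0"
      by (auto intro: inverse_le_1_iff[THEN iffD2])
    then show ?thesis using u by (simp add: s_def abs_if)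
  qed
  define K where "K = insert (G u) (range (\<lambda>n. G (s n)))"
  have maps: "f \<in> ball 0 1 \<rightarrow> target_ball N"
    and pm: "proper_map (top_of_set (ball 0 1)) (top_of_set (target_ball N)) f"
    using proper by (auto simp: proper_holomorphic_map_def)
  have "(\<lambda>n. G (s n)) \<longlonglongrightarrow> G u"
    using cont s_lim continuous_on_tendsto_compose by force
  then have "compactin euclidean K"
    unfolding K_def
    by (intro compactin_sequence_with_limit) auto
  moreover have "K \<subseteq> target_ball N"
    using maps s_ball fG Gu unfolding K_def by (metis (no_types, lifting) PiE insert_subset image_subsetI Pi_mem)
  ultimately have "compactin (top_of_set (target_ball N)) K"
    by (simp add: compactin_subtopology)
  from compactin_proper_map_preimage[OF pm this]
  have "compact {z \<in> ball 0 1. f z \<in> K}"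
    by (simp add: compactin_subtopology)
  then have "closed {z \<in> ball 0 1. f z \<in> K}" by (rule compact_imp_closed)
  moreover have "s n \<in> {z \<in> ball 0 1. f z \<in> K}" for n
    using s_ball[of n] fG[of "s n"] by (auto simp: K_def)
  ultimately have "u \<in> {z \<in> ball 0 1. f z \<in> K}"
    using s_lim by (metis (no_types, lifting) closed_sequentially)
  with u show False by simp
qed

text \<open>
  On the sphere, continuity bounds the form by \<open>1\<close> and properness excludes smaller values. If only
  the constant term were present, the map would have norm \<open>1\<close> at the origin as well. Components that
  are multiples of the same monomial are merged, whence an inequality for the number of terms.
\<close>

lemma monomial_proper_map_sphere_form:
  assumes g: "monomial_proper_map N (g :: 'n::finite cmap)"
  obtains p where "sphere_form p" "card {\<alpha>. p \<alpha> \<noteq> 0} \<le> N"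
    "\<And>z. z \<in> ball 0 1 \<Longrightarrow> sqnorm N g z = diag_form p z"
proof -
  have proper: "proper_holomorphic_map N g"
    using g by (simp add: monomial_proper_map_def)
  then have gball: "g z \<in> target_ball N" if "z \<in> ball 0 1" for z
    using that by (auto simp: proper_holomorphic_map_def)
  have "\<forall>i. \<exists>a \<alpha>. i < N \<longrightarrow> (\<forall>z\<in>ball 0 1. g z i = a * monom_val z \<alpha>)"
    using g unfolding monomial_proper_map_def monomial_map_def by blast
  then obtain a e where ae: "\<And>i z. i < N \<Longrightarrow> z \<in> ball 0 1 \<Longrightarrow> g z i = a i * monom_val z (e i)"
    by metis
  define G where "G z i = (if i < N then a i * monom_val z (e i) else 0)" for z i
  have gG: "g z = G z" if "z \<in> ball 0 1" for z
    using gball[OF that] ae[OF _ that] by (auto simp: G_def target_ball_def)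
  define p where "p \<alpha> = (\<Sum>i | i < N \<and> e i = \<alpha>. (cmod (a i))\<^sup>2)" for \<alpha>
  have p0: "p \<alpha> = 0" if "\<alpha> \<notin> e ` {..<N}" for \<alpha>
    unfolding p_def using that by (intro sum.neutral) auto
  have supp: "{\<alpha>. p \<alpha> \<noteq> 0} \<subseteq> e ` {..<N}"
    using p0 by auto
  have fin: "finite {\<alpha>. p \<alpha> \<noteq> 0}"
    using supp by (rule finite_subset) simp
  have Gp: "sqnorm N G z = diag_form p z" for z
  proof -
    have "diag_form p z = (\<Sum>\<alpha>\<in>e ` {..<N}. p \<alpha> * (cmod (monom_val z \<alpha>))\<^sup>2)"
      using p0 by (intro diag_form_superset) auto
    also have "\<dots> = (\<Sum>\<alpha>\<in>e ` {..<N}. \<Sum>i | i \<in> {..<N} \<and> e i = \<alpha>. (cmod (G z i))\<^sup>2)"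
      by (intro sum.cong) (auto simp: p_def sum_distrib_right G_def norm_mult power_mult_distrib)
    also have "\<dots> = sqnorm N G z"
      unfolding sqnorm_def by (rule sum.image_gen[symmetric]) simp
    finally show ?thesis by simp
  qed
  have eq: "sqnorm N g z = diag_form p z" if "z \<in> ball 0 1" for z
    using Gp[of z] gG[OF that] by (simp add: sqnorm_def)
  have lt: "diag_form p z < 1" if "z \<in> ball 0 1" for z
    using gball[OF that] eq[OF that] by (auto simp: target_ball_def sqnorm_def)
  have contG: "continuous_on UNIV G"
  proof (rule continuous_on_coordinatewise_then_product)
    show "continuous_on UNIV (\<lambda>z. G z i)" for i
      by (cases "i < N") (auto simp: G_def intro!: continuous_intros)
  qed
  have sphere: "diag_form p u = 1" if "norm u = 1" for u
  proof (rule antisym)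
    show "diag_form p u \<ge> 1"
      using proper_extension_sqnorm_ge_1[OF proper contG _ gG that] Gp by (simp add: G_def)
    have cont: "continuous_on (closure (ball 0 1)) (diag_form p)"
      unfolding diag_form_def[abs_def] by (intro continuous_intros)
    show "diag_form p u \<le> 1"
      by (rule continuous_le_on_closure[OF cont]) (use that lt in \<open>auto intro: less_imp_le\<close>)
  qed
  have "\<exists>\<alpha>. \<alpha> \<noteq> (\<lambda>_. 0) \<and> p \<alpha> \<noteq> 0"
  proof (rule ccontr)
    assume *: "\<not> (\<exists>\<alpha>. \<alpha> \<noteq> (\<lambda>_. 0) \<and> p \<alpha> \<noteq> 0)"
    obtain u :: "complex ^ 'n" where u: "norm u = 1" using generic_unit_vector by blast
    have "diag_form p z = p (\<lambda>_. 0)" for z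
      using * fin by (intro diag_form_constant) auto
    then show False
      using sphere[OF u] lt[of 0] by simp
  qed
  moreover have "p \<alpha> \<ge> 0" for \<alpha>
    unfolding p_def by (simp add: sum_nonneg)
  ultimately have "sphere_form p"
    using fin sphere by (simp add: sphere_form_def)
  moreover have "card {\<alpha>. p \<alpha> \<noteq> 0} \<le> N"
    using card_mono[OF _ supp] card_image_le[of "{..<N}" e] by simp
  ultimately show ?thesis
    using that eq by blast
qed

lemma holomorphic_several_const: "holomorphic_several (\<lambda>_. c) S"
  unfolding holomorphic_several_def by (auto intro!: exI[of _ "\<lambda>_. 0"])

lemma holomorphic_several_nth: "holomorphic_several (\<lambda>z. z $ i) S"
  unfolding holomorphic_several_def
  by (auto intro!: exI[of _ "\<lambda>v. v $ i"] bounded_linear_imp_has_derivative bounded_linear_vec_nth)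

lemma holomorphic_several_mult:
  assumes "holomorphic_several f S" "holomorphic_several g S"
  shows "holomorphic_several (\<lambda>z. f z * g z) S"
  unfolding holomorphic_several_def
proof
  fix z assume "z \<in> S"
  then obtain D E where D: "(f has_derivative D) (at z)" "\<forall>a v. D (a *s v) = a * D v"
    and E: "(g has_derivative E) (at z)" "\<forall>a v. E (a *s v) = a * E v"
    using assms unfolding holomorphic_several_def by meson
  have "((\<lambda>z. f z * g z) has_derivative (\<lambda>v. f z * E v + D v * g z)) (at z)"
    by (rule has_derivative_mult[OF D(1) E(1)])
  then show "\<exists>D. ((\<lambda>z. f z * g z) has_derivative D) (at z) \<and> (\<forall>a v. D (a *s v) = a * D v)"
    using D(2) E(2) by (intro exI[of _ "\<lambda>v. f z * E v + D v * g z"]) (simp add: algebra_simps)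
qed

lemma holomorphic_several_power: "holomorphic_several f S \<Longrightarrow> holomorphic_several (\<lambda>z. f z ^ n) S"
  by (induction n) (auto intro: holomorphic_several_const holomorphic_several_mult)

lemma holomorphic_several_monom: "holomorphic_several (\<lambda>z. c * monom_val z \<alpha>) S"
proof -
  have "holomorphic_several (\<lambda>z. \<Prod>i\<in>I. (z $ i) ^ \<alpha> i) S" if "finite I" for I
    using that
    by induction (auto intro!: holomorphic_several_const holomorphic_several_mult
        holomorphic_several_power holomorphic_several_nth)
  then show ?thesis
    unfolding monom_val_def by (intro holomorphic_several_mult holomorphic_several_const) simp
qed

text \<open>
  The map with components \<open>sqrt (p \<alpha>) z\<^sup>\<alpha>\<close> is continuous on the
  closed ball, hence proper there by compactness, and the preimage of the open target ball is
  exactly the open ball. Restriction to a full preimage preserves properness.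
\<close>

lemma sphere_form_monomial_proper_map:
  fixes p :: "('n::finite \<Rightarrow> nat) \<Rightarrow> real"
  assumes p: "sphere_form p" and N: "card {\<alpha>. p \<alpha> \<noteq> 0} \<le> N"
  obtains h where "monomial_proper_map N h" "\<And>z. sqnorm N h z = diag_form p z"
    "\<forall>\<alpha>. p \<alpha> \<noteq> 0 \<longrightarrow> sum \<alpha> UNIV \<le> map_degree N h"
proof -
  define S where "S = {\<alpha>. p \<alpha> \<noteq> 0}"
  have fin: "finite S" and nonneg: "p \<alpha> \<ge> 0" and sphere: "norm u = 1 \<Longrightarrow> diag_form p u = 1" for \<alpha> u
    using p by (auto simp: sphere_form_def S_def)
  obtain e where e: "bij_betw e {..<card S} S"
    using ex_bij_betw_nat_finite[OF fin] by (auto simp: atLeast0LessThan)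
  define a where "a i = (if i < card S then complex_of_real (sqrt (p (e i))) else 0)" for i
  define h :: "'n cmap" where "h z i = a i * monom_val z (e i)" for z i
  have h0: "h z i = 0" if "i \<ge> N" for z i
    using that N by (simp add: h_def a_def S_def)
  have sq: "sqnorm N h z = diag_form p z" for z
  proof -
    have "sqnorm N h z = (\<Sum>i<card S. (cmod (h z i))\<^sup>2)"
      unfolding sqnorm_def using N by (intro sum.mono_neutral_right) (auto simp: h_def a_def S_def)
    also have "\<dots> = (\<Sum>i<card S. p (e i) * (cmod (monom_val z (e i)))\<^sup>2)"
      using nonneg by (intro sum.cong) (auto simp: h_def a_def norm_mult power_mult_distrib)
    also have "\<dots> = diag_form p z"
      unfolding diag_form_def S_def[symmetric] by (rule sum.reindex_bij_betw[OF e])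
    finally show ?thesis .
  qed
  have in_target: "h z \<in> target_ball N \<longleftrightarrow> z \<in> ball 0 1" if "z \<in> cball 0 1" for z
  proof -
    have "h z \<in> target_ball N \<longleftrightarrow> diag_form p z < 1"
      using sq[of z] h0 by (auto simp: target_ball_def sqnorm_def)
    then show ?thesis
      using that sphere[of z] sphere_form_less_1[OF p, of z] by fastforce
  qed
  have cont: "continuous_on (cball 0 1) h"
    by (rule continuous_on_coordinatewise_then_product) (auto simp: h_def intro!: continuous_intros)
  have "proper_map (top_of_set (cball 0 1)) euclidean h"
    by (rule continuous_imp_proper_map)
      (use cont in \<open>auto simp: Hausdorff_imp_kc_space compact_space_subtopology\<close>)
  then have "proper_map (subtopology (top_of_set (cball 0 1)) (ball 0 1)) (top_of_set (target_ball N)) h"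
    by (rule proper_map_restriction) (use in_target in auto)
  moreover have "subtopology (top_of_set (cball 0 1)) (ball 0 1) = top_of_set (ball (0 :: complex ^ 'n) 1)"
    by (simp add: subtopology_subtopology Int_absorb1 ball_subset_cball)
  ultimately have "proper_holomorphic_map N h"
    using in_target unfolding proper_holomorphic_map_def holomorphic_map_def
    by (auto simp: h_def intro: holomorphic_several_monom)
  then have "monomial_proper_map N h"
    by (auto simp: monomial_proper_map_def monomial_map_def h_def)
  moreover have "sum \<alpha> UNIV \<le> map_degree N h" if \<alpha>: "p \<alpha> \<noteq> 0" for \<alpha>
  proof -
    obtain i where i: "i < card S" "e i = \<alpha>"
      using e \<alpha> unfolding bij_betw_def S_def by (metis (mono_tags, lifting) imageE lessThan_iff mem_Collect_eq)
    have "a i \<noteq> 0" using i \<alpha> by (simp add: a_def)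
    have "poly_of (\<lambda>z. h z i) = Poly_Mapping.single \<alpha> (a i)"
      using \<open>a i \<noteq> 0\<close> by (intro poly_of_eqI) (simp add: cpoly_val_def h_def i)
    then have "cpoly_degree (poly_of (\<lambda>z. h z i)) = sum \<alpha> UNIV"
      using \<open>a i \<noteq> 0\<close> by (simp add: cpoly_degree_def)
    moreover have "i < N" using i N by (simp add: S_def)
    ultimately show ?thesis
      unfolding map_degree_def by (intro Max_ge) force+
  qed
  ultimately show ?thesis using that sq by blast
qed

section \<open>Polarization and the degree\<close>

lemma holomorphic_on_complex_line:
  assumes f: "holomorphic_several f U" and S: "\<And>s. s \<in> S \<Longrightarrow> P + s *s Q \<in> U"
  shows "(\<lambda>s. f (P + s *s Q)) holomorphic_on S"
  unfolding holomorphic_on_def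
proof
  fix s assume "s \<in> S"
  then obtain D where D: "(f has_derivative D) (at (P + s *s Q))" "\<forall>a v. D (a *s v) = a * D v"
    using f S unfolding holomorphic_several_def by blast
  have "linear (\<lambda>s. s *s Q)"
    by (rule linearI) (simp_all add: vec_eq_iff algebra_simps)
  then have "((\<lambda>s. P + s *s Q) has_derivative (\<lambda>h. 0 + h *s Q)) (at s)"
    by (intro has_derivative_add has_derivative_const bounded_linear_imp_has_derivative)
      (simp add: linear_conv_bounded_linear)
  then have "((\<lambda>s. f (P + s *s Q)) has_derivative (\<lambda>h. D (0 + h *s Q))) (at s)"
    using D(1) by (rule has_derivative_compose)
  moreover have "(\<lambda>h. D (0 + h *s Q)) = (\<lambda>h. D Q * h)"
    using D(2) by (simp add: mult.commute)
  ultimately have "((\<lambda>s. f (P + s *s Q)) has_field_derivative D Q) (at s)"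
    by (simp add: has_field_derivative_def)
  then show "(\<lambda>s. f (P + s *s Q)) field_differentiable at s within S"
    using field_differentiable_at_within field_differentiable_def by blast
qed

text \<open>
  The complex line \<open>s \<mapsto> P + s Q\<close> chosen below passes through \<open>z\<close>
  at \<open>\<i>\<close> and through \<open>w\<close> at \<open>- \<i>\<close>. For holomorphic
  \<open>f\<close>, the product of \<open>f (P + s Q)\<close> and the conjugate of
  \<open>f (P + cnj s Q)\<close> is holomorphic in \<open>s\<close>, and it is a squared modulus for
  real \<open>s\<close>. By the identity theorem the equality of the squared norms at real
  \<open>s\<close> propagates to \<open>s = \<i>\<close>.
\<close>

lemma polarization:
  fixes u :: "'i \<Rightarrow> complex ^ 'n::finite \<Rightarrow> complex" and v :: "'j \<Rightarrow> complex ^ 'n \<Rightarrow> complex"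
  assumes u: "\<And>i. i \<in> I \<Longrightarrow> holomorphic_several (u i) (ball 0 1)"
    and v: "\<And>j. j \<in> J \<Longrightarrow> holomorphic_several (v j) (ball 0 1)"
    and eq: "\<And>z. z \<in> ball 0 1 \<Longrightarrow> (\<Sum>i\<in>I. (cmod (u i z))\<^sup>2) = (\<Sum>j\<in>J. (cmod (v j z))\<^sup>2)"
    and z: "z \<in> ball 0 1" and w: "w \<in> ball 0 1"
  shows "(\<Sum>i\<in>I. u i z * cnj (u i w)) = (\<Sum>j\<in>J. v j z * cnj (v j w))"
proof -
  define P where "P = (1 / 2) *\<^sub>R (z + w)"
  define Q where "Q = (- \<i> / 2) *s (z - w)"
  define line where "line s = P + s *s Q" for s
  have line_i: "line \<i> = z" "line (cnj \<i>) = w"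
    by (simp_all add: line_def P_def Q_def vec_eq_iff scaleR_conv_of_real[where 'a = complex] field_simps)
  have line_affine: "line (a *\<^sub>R s + b *\<^sub>R t) = a *\<^sub>R line s + b *\<^sub>R line t" if "a + b = 1" for a b s t
  proof -
    have "P = a *\<^sub>R P + b *\<^sub>R P"
      using that by (metis scaleR_add_left scaleR_one)
    then show ?thesis
      unfolding line_def by (simp add: vec_eq_iff scaleR_conv_of_real[where 'a = complex] algebra_simps)
  qed
  have cont_line: "continuous_on UNIV line"
    unfolding line_def vector_scalar_mult_def by (intro continuous_intros)
  define S where "S = {s. line s \<in> ball 0 1 \<and> line (cnj s) \<in> ball 0 1}"
  have "open S"
  proof -
    have "open (line -` ball 0 1)"
      by (rule open_vimage[OF open_ball cont_line])
    moreover have "open ((\<lambda>s. line (cnj s)) -` ball 0 1)"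
      by (rule open_vimage[OF open_ball]) (intro continuous_on_compose2[OF cont_line] continuous_intros, simp)
    moreover have "S = line -` ball 0 1 \<inter> (\<lambda>s. line (cnj s)) -` ball 0 1"
      by (auto simp: S_def)
    ultimately show ?thesis by (simp add: open_Int)
  qed
  have conv: "convex S"
  proof (rule convexI)
    fix s t a b assume *: "s \<in> S" "t \<in> S" "0 \<le> a" "0 \<le> b" "a + (b :: real) = 1"
    have "cnj (a *\<^sub>R s + b *\<^sub>R t) = a *\<^sub>R cnj s + b *\<^sub>R cnj t" by simp
    then show "a *\<^sub>R s + b *\<^sub>R t \<in> S"
      using * by (auto simp only: S_def mem_Collect_eq line_affine intro!: convexD[OF convex_ball])
  qed
  have iS: "\<i> \<in> S" "- \<i> \<in> S"
    using line_i z w by (simp_all add: S_def)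
  have "0 \<in> S"
    using convexD[OF conv iS, of "1 / 2" "1 / 2"] by simp
  have limpt: "0 islimpt (S \<inter> \<real>)"
    unfolding islimpt_approachable
  proof (intro allI impI)
    fix e :: real assume "e > 0"
    obtain d where d: "d > 0" "ball 0 d \<subseteq> S"
      using \<open>open S\<close> \<open>0 \<in> S\<close> open_contains_ball by blast
    define x where "x = complex_of_real (min d e / 2)"
    have "norm x < d" "norm x < e" "x \<noteq> 0"
      using d(1) \<open>e > 0\<close> by (auto simp: x_def norm_divide)
    moreover have "x \<in> \<real>" by (simp add: x_def)
    moreover have "x \<in> S" using d(2) \<open>norm x < d\<close> by auto
    ultimately show "\<exists>x\<in>S \<inter> \<real>. x \<noteq> 0 \<and> dist x 0 < e" by auto
  qed
  have hol: "(\<lambda>s. f (line s) * cnj (f (line (cnj s)))) holomorphic_on S"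
    if f: "holomorphic_several f (ball 0 1)" for f
  proof -
    have "(\<lambda>s. f (line s)) holomorphic_on S"
      unfolding line_def by (rule holomorphic_on_complex_line[OF f]) (simp add: S_def line_def)
    moreover have "(cnj \<circ> (\<lambda>s. f (line s)) \<circ> cnj) holomorphic_on S"
    proof (rule holomorphic_on_compose_cnj_cnj[OF _ \<open>open S\<close>])
      show "(\<lambda>s. f (line s)) holomorphic_on cnj ` S"
        unfolding line_def by (rule holomorphic_on_complex_line[OF f]) (auto simp: S_def line_def)
    qed
    ultimately show ?thesis
      by (auto simp: o_def intro!: holomorphic_intros)
  qed
  define F where "F s = (\<Sum>i\<in>I. u i (line s) * cnj (u i (line (cnj s)))) -
      (\<Sum>j\<in>J. v j (line s) * cnj (v j (line (cnj s))))" for s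
  have "F holomorphic_on S"
    unfolding F_def by (intro holomorphic_intros hol u v)
  moreover have "F s = 0" if "s \<in> S \<inter> \<real>" for s
  proof -
    have "cnj s = s" using that by (simp add: Reals_cnj_iff)
    then have "F s = complex_of_real ((\<Sum>i\<in>I. (cmod (u i (line s)))\<^sup>2) - (\<Sum>j\<in>J. (cmod (v j (line s)))\<^sup>2))"
      by (simp add: F_def flip: complex_norm_square)
    moreover have "(\<Sum>i\<in>I. (cmod (u i (line s)))\<^sup>2) - (\<Sum>j\<in>J. (cmod (v j (line s)))\<^sup>2) = 0"
      using eq[of "line s"] that by (simp add: S_def)
    ultimately show ?thesis by (simp only: of_real_0)
  qed
  ultimately have "F \<i> = 0"
    using analytic_continuation[OF _ \<open>open S\<close> convex_connected[OF conv] _ \<open>0 \<in> S\<close> limpt _ iS(1)] by blast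
  then show ?thesis
    unfolding F_def line_i by simp
qed

text \<open>
  The functional dual to the monomial \<open>\<alpha>\<close>, applied to the components of
  \<open>f\<close>, gives a vector \<open>v \<alpha>\<close>. By the polarized identity these
  vectors are orthogonal with squared lengths \<open>p \<alpha>\<close>, and the inner product of
  \<open>f z\<close> with \<open>v \<alpha>\<close> is \<open>p \<alpha> z\<^sup>\<alpha>\<close>.
  The hypothesis on the squared norm is then the case of equality in Bessel's inequality, so
  \<open>f z\<close> is the sum of its projections \<open>z\<^sup>\<alpha> v \<alpha>\<close>.
\<close>

lemma components_in_span_of_monomials:
  fixes f :: "'n::finite cmap"
  assumes f: "holomorphic_map M f" and fin: "finite {\<alpha>. p \<alpha> \<noteq> 0}" and nonneg: "\<And>\<alpha>. p \<alpha> \<ge> 0"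
    and eq: "\<And>z. z \<in> ball 0 1 \<Longrightarrow> sqnorm M f z = diag_form p z"
  obtains v where "\<And>i z. i < M \<Longrightarrow> z \<in> ball 0 1 \<Longrightarrow> f z i = (\<Sum>\<alpha> | p \<alpha> \<noteq> 0. v \<alpha> i * monom_val z \<alpha>)"
proof -
  define S where "S = {\<alpha>. p \<alpha> \<noteq> 0}"
  have finS: "finite S" using fin by (simp add: S_def)
  have polar: "(\<Sum>i<M. f z i * cnj (f w i)) = (\<Sum>\<alpha>\<in>S. p \<alpha> * (monom_val z \<alpha> * cnj (monom_val w \<alpha>)))"
    if zw: "z \<in> ball 0 1" "w \<in> ball 0 1" for z w
  proof -
    have "(\<Sum>i<M. f z i * cnj (f w i)) = (\<Sum>\<alpha>\<in>S. (complex_of_real (sqrt (p \<alpha>)) * monom_val z \<alpha>) *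
        cnj (complex_of_real (sqrt (p \<alpha>)) * monom_val w \<alpha>))"
      by (rule polarization[where u = "\<lambda>i z. f z i" and v = "\<lambda>\<alpha> z. complex_of_real (sqrt (p \<alpha>)) * monom_val z \<alpha>", OF _ _ _ zw])
        (use f eq nonneg in \<open>auto simp: holomorphic_map_def sqnorm_def diag_form_def S_def norm_mult power_mult_distrib
          intro: holomorphic_several_monom\<close>)
    also have "\<dots> = (\<Sum>\<alpha>\<in>S. p \<alpha> * (monom_val z \<alpha> * cnj (monom_val w \<alpha>)))"
    proof (rule sum.cong[OF refl])
      fix \<alpha>
      have "complex_of_real (p \<alpha>) = complex_of_real (sqrt (p \<alpha>)) * complex_of_real (sqrt (p \<alpha>))"
        using nonneg[of \<alpha>] by (simp flip: of_real_mult)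
      then show "complex_of_real (sqrt (p \<alpha>)) * monom_val z \<alpha> * cnj (complex_of_real (sqrt (p \<alpha>)) * monom_val w \<alpha>)
          = p \<alpha> * (monom_val z \<alpha> * cnj (monom_val w \<alpha>))"
        by simp
    qed
    finally show ?thesis .
  qed
  have "\<exists>xs. snd ` set xs \<subseteq> ball 0 1 \<and>
      (\<forall>\<beta>\<in>S. point_eval xs (\<lambda>w. monom_val w \<beta>) = (if \<beta> = \<alpha> then 1 else 0))" for \<alpha>
  proof -
    obtain xs where xs: "snd ` set xs \<subseteq> ball 0 1"
      "\<And>\<nu>. \<nu> \<in> insert (\<alpha>, \<lambda>_. 0) ((\<lambda>\<beta>. (\<beta>, \<lambda>_. 0)) ` S) \<Longrightarrow>
         point_eval xs (bimonom \<nu>) = (if \<nu> = (\<alpha>, \<lambda>_. 0) then 1 else 0)"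
      using dual_point_eval[of "(\<lambda>\<beta>. (\<beta>, \<lambda>_. 0)) ` S" 1 "(\<alpha>, \<lambda>_. 0)"] finS by auto
    have "bimonom (\<beta>, \<lambda>_. 0) = (\<lambda>w. monom_val w \<beta>)" for \<beta> :: "'n \<Rightarrow> nat"
      by (simp add: fun_eq_iff bimonom_def monom_val_def)
    then have "point_eval xs (\<lambda>w. monom_val w \<beta>) = (if \<beta> = \<alpha> then 1 else 0)" if "\<beta> \<in> S" for \<beta>
      using xs(2)[of "(\<beta>, \<lambda>_. 0)"] that by simp
    with xs(1) show ?thesis by blast
  qed
  then obtain xs where xs_ball: "\<And>\<alpha>. snd ` set (xs \<alpha>) \<subseteq> ball 0 1"
    and dual: "\<And>\<alpha> \<beta>. \<beta> \<in> S \<Longrightarrow> point_eval (xs \<alpha>) (\<lambda>w. monom_val w \<beta>) = (if \<beta> = \<alpha> then 1 else 0)"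
    by metis
  define v where "v \<alpha> i = point_eval (xs \<alpha>) (\<lambda>w. f w i)" for \<alpha> i
  have vf: "(\<Sum>i<M. v \<alpha> i * cnj (f z i)) = p \<alpha> * cnj (monom_val z \<alpha>)"
    if "\<alpha> \<in> S" "z \<in> ball 0 1" for \<alpha> z
  proof -
    have "(\<Sum>i<M. v \<alpha> i * cnj (f z i)) = point_eval (xs \<alpha>) (\<lambda>w. \<Sum>i<M. cnj (f z i) * f w i)"
      by (simp add: v_def point_eval_sum point_eval_cmult mult.commute[of "point_eval _ _"])
    also have "\<dots> = point_eval (xs \<alpha>) (\<lambda>w. \<Sum>\<beta>\<in>S. (p \<beta> * cnj (monom_val z \<beta>)) * monom_val w \<beta>)"
    proof (rule point_eval_cong)
      fix x assume "x \<in> set (xs \<alpha>)"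
      then have "snd x \<in> ball 0 1" using xs_ball[of \<alpha>] by auto
      from polar[OF this that(2)]
      show "(\<Sum>i<M. cnj (f z i) * f (snd x) i) = (\<Sum>\<beta>\<in>S. (p \<beta> * cnj (monom_val z \<beta>)) * monom_val (snd x) \<beta>)"
        by (simp add: mult_ac)
    qed
    also have "\<dots> = (\<Sum>\<beta>\<in>S. (p \<beta> * cnj (monom_val z \<beta>)) * (if \<beta> = \<alpha> then 1 else 0))"
      unfolding point_eval_sum point_eval_cmult by (intro sum.cong) (simp_all add: dual)
    also have "\<dots> = p \<alpha> * cnj (monom_val z \<alpha>)"
      using that(1) finS by (simp add: if_distrib cong: if_cong)
    finally show ?thesis .
  qed
  have vv: "(\<Sum>i<M. v \<alpha> i * cnj (v \<beta> i)) = (if \<beta> = \<alpha> then complex_of_real (p \<alpha>) else 0)" if "\<alpha> \<in> S" for \<alpha> \<beta>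
  proof -
    have "cnj (\<Sum>i<M. v \<alpha> i * cnj (v \<beta> i)) = point_eval (xs \<beta>) (\<lambda>w. \<Sum>i<M. cnj (v \<alpha> i) * f w i)"
      by (simp add: v_def[of \<beta>] point_eval_sum point_eval_cmult)
    also have "\<dots> = point_eval (xs \<beta>) (\<lambda>w. p \<alpha> * monom_val w \<alpha>)"
    proof (rule point_eval_cong)
      fix x assume "x \<in> set (xs \<beta>)"
      then have "snd x \<in> ball 0 1" using xs_ball[of \<beta>] by auto
      from arg_cong[OF vf[OF that this], of cnj]
      show "(\<Sum>i<M. cnj (v \<alpha> i) * f (snd x) i) = p \<alpha> * monom_val (snd x) \<alpha>"
        by simp
    qed
    also have "\<dots> = (if \<beta> = \<alpha> then complex_of_real (p \<alpha>) else 0)"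
      using that by (auto simp: point_eval_cmult dual)
    finally show ?thesis
      by (metis complex_cnj_cnj complex_cnj_complex_of_real complex_cnj_zero)
  qed
  have "f z i = (\<Sum>\<alpha>\<in>S. v \<alpha> i * monom_val z \<alpha>)" if i: "i < M" and z: "z \<in> ball 0 1" for i z
  proof -
    define Y where "Y i = (\<Sum>\<alpha>\<in>S. v \<alpha> i * monom_val z \<alpha>)" for i
    define W where "W i = f z i - Y i" for i
    have vY: "(\<Sum>i<M. v \<alpha> i * cnj (Y i)) = p \<alpha> * cnj (monom_val z \<alpha>)" if "\<alpha> \<in> S" for \<alpha>
    proof -
      have "(\<Sum>i<M. v \<alpha> i * cnj (Y i)) = (\<Sum>\<beta>\<in>S. (\<Sum>i<M. v \<alpha> i * cnj (v \<beta> i)) * cnj (monom_val z \<beta>))"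
        unfolding Y_def cnj_sum sum_distrib_left sum_distrib_right
        by (subst sum.swap) (simp add: mult.assoc)
      also have "\<dots> = p \<alpha> * cnj (monom_val z \<alpha>)"
        using that finS by (simp add: vv if_distrib[of "\<lambda>x. x * _"] cong: if_cong)
      finally show ?thesis .
    qed
    have Y_sum: "(\<Sum>i<M. Y i * g i) = (\<Sum>\<alpha>\<in>S. monom_val z \<alpha> * (\<Sum>i<M. v \<alpha> i * g i))" for g
      unfolding Y_def sum_distrib_left sum_distrib_right
      by (subst sum.swap) (simp add: mult_ac)
    \<comment> \<open>The difference \<open>W\<close> is orthogonal to every \<open>v \<alpha>\<close> and to \<open>f z\<close>, hence to itself.\<close>
    have YW: "(\<Sum>i<M. Y i * cnj (W i)) = 0"
      unfolding Y_sum by (rule sum.neutral) (simp add: W_def right_diff_distrib sum_subtractf vf[OF _ z] vY)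
    have "(\<Sum>i<M. Y i * cnj (f z i)) = (\<Sum>i<M. f z i * cnj (f z i))"
      unfolding Y_sum polar[OF z z] by (intro sum.cong) (simp_all add: vf[OF _ z])
    then have "cnj (\<Sum>i<M. Y i * cnj (f z i)) = (\<Sum>i<M. f z i * cnj (f z i))"
      by (simp add: mult.commute)
    then have "(\<Sum>i<M. f z i * cnj (W i)) = 0"
      by (simp add: W_def right_diff_distrib sum_subtractf mult.commute)
    with YW have "(\<Sum>i<M. W i * cnj (W i)) = 0"
      by (simp add: W_def[of i for i] left_diff_distrib sum_subtractf)
    then have "complex_of_real (\<Sum>i<M. (cmod (W i))\<^sup>2) = 0"
      by (simp flip: complex_norm_square)
    then have "(\<Sum>i<M. (cmod (W i))\<^sup>2) = 0"
      using of_real_eq_0_iff by blast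
    then have "W i = 0"
      using i by (simp add: sum_nonneg_eq_0_iff)
    then show ?thesis by (simp add: W_def Y_def)
  qed
  then show ?thesis using that[of v] by (simp add: S_def)
qed

lemma map_degree_le:
  fixes f :: "'n::finite cmap"
  assumes f: "holomorphic_map M f" and fin: "finite {\<alpha>. p \<alpha> \<noteq> 0}" and nonneg: "\<And>\<alpha>. p \<alpha> \<ge> 0"
    and eq: "\<And>z. z \<in> ball 0 1 \<Longrightarrow> sqnorm M f z = diag_form p z"
    and d: "\<And>\<alpha>. p \<alpha> \<noteq> 0 \<Longrightarrow> sum \<alpha> UNIV \<le> d"
  shows "map_degree M f \<le> d"
proof -
  obtain v where v: "\<And>i z. i < M \<Longrightarrow> z \<in> ball 0 1 \<Longrightarrow> f z i = (\<Sum>\<alpha> | p \<alpha> \<noteq> 0. v \<alpha> i * monom_val z \<alpha>)"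
    using components_in_span_of_monomials[OF f fin nonneg eq] by blast
  have "cpoly_degree (poly_of (\<lambda>z. f z i)) \<le> d" if i: "i < M" for i
  proof -
    define P where "P = Abs_poly_mapping (\<lambda>\<alpha>. if p \<alpha> \<noteq> 0 then v \<alpha> i else 0)"
    have lookup: "Poly_Mapping.lookup P \<alpha> = (if p \<alpha> \<noteq> 0 then v \<alpha> i else 0)" for \<alpha>
      unfolding P_def by (subst lookup_Abs_poly_mapping) (auto intro: finite_subset[OF _ fin])
    have keys: "Poly_Mapping.keys P \<subseteq> {\<alpha>. p \<alpha> \<noteq> 0}"
      by (auto simp: in_keys_iff lookup split: if_splits)
    have "poly_of (\<lambda>z. f z i) = P"
      by (rule poly_of_eqI) (simp add: v[OF i] cpoly_val_superset[OF fin keys] lookup)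
    then show ?thesis
      unfolding cpoly_degree_def using keys d by (auto simp: subset_iff)
  qed
  then show ?thesis
    unfolding map_degree_def by auto
qed

section \<open>Sparse points of polyhedra\<close>

text \<open>
  This is the walk from \<open>p\<close> to a vertex of the polyhedron of nonnegative points in
  \<open>p\<close> plus the span of the \<open>b j\<close>, and at least \<open>k\<close>
  coefficients in \<open>T\<close> vanish at the end. One step moves along a single direction until
  a first coefficient \<open>\<tau>\<close> reaches \<open>0\<close>, and then clears
  \<open>\<tau>\<close> from the other directions, which leaves \<open>k - 1\<close> independent
  ones. The direction is oriented so that the coefficient at \<open>\<alpha>0\<close> does not
  decrease, and the positive weights \<open>w z0\<close> force it to have a negative entry, so that
  the move stops.
\<close>

lemma sparse_nonneg_point:
  fixes p :: "'a \<Rightarrow> real" and b :: "nat \<Rightarrow> 'a \<Rightarrow> real" and w :: "'z \<Rightarrow> 'a \<Rightarrow> real"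
  assumes "finite T"
    and "\<And>a. (\<And>\<alpha>. (\<Sum>j<k. a j * b j \<alpha>) = 0) \<Longrightarrow> (\<forall>j<k. a j = 0)"
    and "\<And>j \<alpha>. j < k \<Longrightarrow> \<alpha> \<notin> T \<Longrightarrow> b j \<alpha> = 0"
    and "\<And>j z. j < k \<Longrightarrow> z \<in> Z \<Longrightarrow> (\<Sum>\<alpha>\<in>T. b j \<alpha> * w z \<alpha>) = 0"
    and "z0 \<in> Z" "\<And>\<alpha>. w z0 \<alpha> > 0"
    and "\<And>\<alpha>. p \<alpha> \<ge> 0" "\<And>\<alpha>. \<alpha> \<notin> T \<Longrightarrow> p \<alpha> = 0" "p \<alpha>0 > 0"
  shows "\<exists>q. (\<forall>\<alpha>. q \<alpha> \<ge> 0) \<and> (\<forall>\<alpha>. \<alpha> \<notin> T \<longrightarrow> q \<alpha> = 0) \<and> q \<alpha>0 > 0 \<and>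
    (\<forall>z\<in>Z. (\<Sum>\<alpha>\<in>T. q \<alpha> * w z \<alpha>) = (\<Sum>\<alpha>\<in>T. p \<alpha> * w z \<alpha>)) \<and> card {\<alpha>. q \<alpha> \<noteq> 0} + k \<le> card T"
  using assms
proof (induction k arbitrary: T b p)
  case 0
  have "card {\<alpha>. p \<alpha> \<noteq> 0} \<le> card T"
    using 0 by (intro card_mono) auto
  with 0 show ?case by (intro exI[of _ p]) auto
next
  case (Suc k)
  note fin = Suc.prems(1) and indep = Suc.prems(2) and supp = Suc.prems(3) and zero = Suc.prems(4)
    and p_nonneg = Suc.prems(7) and p_supp = Suc.prems(8)
  define d where "d = (if b k \<alpha>0 \<ge> 0 then b k else (\<lambda>\<alpha>. - b k \<alpha>))"
  have d0: "d \<alpha>0 \<ge> 0" by (simp add: d_def)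
  have d_zero: "(\<Sum>\<alpha>\<in>T. d \<alpha> * w z \<alpha>) = 0" if "z \<in> Z" for z
    using zero[of k, OF _ that] by (simp add: d_def sum_negf)
  have d_supp: "d \<alpha> = 0" if "\<alpha> \<notin> T" for \<alpha> using supp[of k, OF _ that] by (simp add: d_def)
  have "\<exists>\<alpha>. b k \<alpha> \<noteq> 0"
  proof (rule ccontr)
    assume "\<nexists>\<alpha>. b k \<alpha> \<noteq> 0"
    then have "(\<Sum>j<Suc k. (if j = k then 1 else 0) * b j \<alpha>) = 0" for \<alpha> by simp
    from indep[OF this] show False by auto
  qed
  then obtain \<beta>0 where \<beta>0: "d \<beta>0 \<noteq> 0" by (auto simp: d_def)
  have "\<exists>\<beta>\<in>T. d \<beta> < 0"
  proof (rule ccontr)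
    assume "\<not> (\<exists>\<beta>\<in>T. d \<beta> < 0)"
    then have nn: "d \<beta> * w z0 \<beta> \<ge> 0" if "\<beta> \<in> T" for \<beta>
      using that Suc.prems(6)[of \<beta>] by (meson less_imp_le mult_nonneg_nonneg not_less)
    have "\<beta>0 \<in> T" using \<beta>0 d_supp by blast
    then have "d \<beta>0 * w z0 \<beta>0 = 0"
      using sum_nonneg_eq_0_iff[OF fin, of "\<lambda>\<beta>. d \<beta> * w z0 \<beta>"] nn d_zero[OF Suc.prems(5)] by blast
    then show False using \<beta>0 Suc.prems(6)[of \<beta>0] by simp
  qed
  define B where "B = {\<beta> \<in> T. d \<beta> < 0}"
  have B: "finite B" "B \<noteq> {}" using fin \<open>\<exists>\<beta>\<in>T. d \<beta> < 0\<close> by (auto simp: B_def)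
  define ratio where "ratio \<beta> = p \<beta> / (- d \<beta>)" for \<beta>
  \<comment> \<open>The coefficient that vanishes first; it may already be \<open>0\<close>, and then the step has length \<open>0\<close>.\<close>
  obtain \<tau> where \<tau>: "\<tau> \<in> B" "\<And>\<beta>. \<beta> \<in> B \<Longrightarrow> ratio \<tau> \<le> ratio \<beta>"
    using finite_has_minimal[of "ratio ` B"] B by (metis arg_min_if_finite(1) arg_min_least)
  define s where "s = ratio \<tau>"
  have s: "s \<ge> 0" using \<tau>(1) p_nonneg[of \<tau>] by (auto simp: s_def ratio_def B_def divide_nonneg_neg)
  define p' where "p' \<alpha> = p \<alpha> + s * d \<alpha>" for \<alpha>
  have p'_nonneg: "p' \<alpha> \<ge> 0" for \<alpha>
  proof (cases "d \<alpha> < 0")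
    case True
    then have "\<alpha> \<in> B" using d_supp by (force simp: B_def)
    then have "s \<le> p \<alpha> / (- d \<alpha>)" using \<tau>(2) by (simp add: s_def ratio_def)
    then show ?thesis using True by (simp add: p'_def field_simps)
  next
    case False
    then show ?thesis using s p_nonneg[of \<alpha>] by (simp add: p'_def)
  qed
  have d\<tau>: "d \<tau> < 0" "\<tau> \<in> T" using \<tau>(1) by (auto simp: B_def)
  then have p'\<tau>: "p' \<tau> = 0" by (simp add: p'_def s_def ratio_def)
  have b\<tau>: "b k \<tau> \<noteq> 0" using d\<tau>(1) by (auto simp: d_def split: if_splits)
  define r where "r j = b j \<tau> / b k \<tau>" for j
  define b' where "b' j \<alpha> = b j \<alpha> - r j * b k \<alpha>" for j \<alpha>
  have b'\<tau>: "b' j \<tau> = 0" for j using b\<tau> by (simp add: b'_def r_def)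
  have del: "(\<Sum>\<alpha>\<in>T - {\<tau>}. g \<alpha> * w z \<alpha>) = (\<Sum>\<alpha>\<in>T. g \<alpha> * w z \<alpha>)" if "g \<tau> = 0" for g z
    using fin that by (intro sum.mono_neutral_left) auto
  have "\<exists>q. (\<forall>\<alpha>. q \<alpha> \<ge> 0) \<and> (\<forall>\<alpha>. \<alpha> \<notin> T - {\<tau>} \<longrightarrow> q \<alpha> = 0) \<and> q \<alpha>0 > 0 \<and>
    (\<forall>z\<in>Z. (\<Sum>\<alpha>\<in>T - {\<tau>}. q \<alpha> * w z \<alpha>) = (\<Sum>\<alpha>\<in>T - {\<tau>}. p' \<alpha> * w z \<alpha>)) \<and> card {\<alpha>. q \<alpha> \<noteq> 0} + k \<le> card (T - {\<tau>})"
  proof (rule Suc.IH[of "T - {\<tau>}" b' p'])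
    fix a assume a: "\<And>\<alpha>. (\<Sum>j<k. a j * b' j \<alpha>) = 0"
    \<comment> \<open>Substituting back the eliminated direction turns a relation between the \<open>b' j\<close> into one between the \<open>b j\<close>.\<close>
    define a' where "a' j = (if j = k then - (\<Sum>j<k. a j * r j) else a j)" for j
    have eq: "(\<Sum>j<Suc k. a' j * b j \<alpha>) = (\<Sum>j<k. a j * b' j \<alpha>)" for \<alpha>
      by (simp add: a'_def b'_def right_diff_distrib sum_subtractf sum_distrib_right mult.assoc)
    have "\<forall>j<Suc k. a' j = 0" by (rule indep) (simp only: eq a)
    then show "\<forall>j<k. a j = 0" by (auto simp: a'_def dest: less_SucI)
  next
    fix j \<alpha> assume "j < k" "\<alpha> \<notin> T - {\<tau>}"
    then show "b' j \<alpha> = 0" using b'\<tau>[of j] supp[of j \<alpha>] supp[of k \<alpha>] by (auto simp: b'_def)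
  next
    fix j z assume jz: "j < k" "z \<in> Z"
    have "(\<Sum>\<alpha>\<in>T. b' j \<alpha> * w z \<alpha>) = (\<Sum>\<alpha>\<in>T. b j \<alpha> * w z \<alpha>) - r j * (\<Sum>\<alpha>\<in>T. b k \<alpha> * w z \<alpha>)"
      by (simp add: b'_def left_diff_distrib sum_subtractf sum_distrib_left mult.assoc)
    then show "(\<Sum>\<alpha>\<in>T - {\<tau>}. b' j \<alpha> * w z \<alpha>) = 0"
      using del[of "b' j"] b'\<tau> zero[of j z] zero[of k z] jz by simp
  next
    fix \<alpha> assume "\<alpha> \<notin> T - {\<tau>}"
    then show "p' \<alpha> = 0" using p'\<tau> p_supp d_supp by (auto simp: p'_def)
  next
    show "p' \<alpha>0 > 0" using Suc.prems(9) s d0 by (simp add: p'_def add_pos_nonneg)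
  qed (use fin Suc.prems(5,6) p'_nonneg in auto)
  then obtain q where q: "\<forall>\<alpha>. q \<alpha> \<ge> 0" "\<forall>\<alpha>. \<alpha> \<notin> T - {\<tau>} \<longrightarrow> q \<alpha> = 0" "q \<alpha>0 > 0"
    "\<forall>z\<in>Z. (\<Sum>\<alpha>\<in>T - {\<tau>}. q \<alpha> * w z \<alpha>) = (\<Sum>\<alpha>\<in>T - {\<tau>}. p' \<alpha> * w z \<alpha>)" "card {\<alpha>. q \<alpha> \<noteq> 0} + k \<le> card (T - {\<tau>})"
    by blast
  have "(\<Sum>\<alpha>\<in>T. q \<alpha> * w z \<alpha>) = (\<Sum>\<alpha>\<in>T. p \<alpha> * w z \<alpha>)" if "z \<in> Z" for z
  proof -
    have "(\<Sum>\<alpha>\<in>T. p' \<alpha> * w z \<alpha>) = (\<Sum>\<alpha>\<in>T. p \<alpha> * w z \<alpha>) + s * (\<Sum>\<alpha>\<in>T. d \<alpha> * w z \<alpha>)"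
      by (simp add: p'_def distrib_right sum.distrib sum_distrib_left mult.assoc)
    moreover have "(\<Sum>\<alpha>\<in>T. q \<alpha> * w z \<alpha>) = (\<Sum>\<alpha>\<in>T. p' \<alpha> * w z \<alpha>)"
      using q(2,4) that del[of q z] del[of p' z] p'\<tau> by simp
    ultimately show ?thesis using d_zero[OF that] by simp
  qed
  moreover have "card (T - {\<tau>}) + 1 = card T" using fin d\<tau>(2)
    by (metis Suc_eq_plus1 card_Suc_Diff1)
  ultimately show ?case
    using q by (intro exI[of _ q]) auto
qed

section \<open>Convex families\<close>

lemma in_P_infinity_scale:
  assumes "in_P_infinity R" "a \<ge> 0"
  shows "in_P_infinity (\<lambda>z. a * R z)"
proof -
  obtain M f where f: "holomorphic_map M f" "\<forall>z\<in>ball 0 1. R z = sqnorm M f z"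
    using assms(1) by (auto simp: in_P_infinity_def)
  define g where "g z i = complex_of_real (sqrt a) * f z i" for z i
  have "holomorphic_map M g"
    using f(1) unfolding holomorphic_map_def g_def
    by (auto intro!: holomorphic_several_mult holomorphic_several_const)
  moreover have "a * R z = sqnorm M g z" if "z \<in> ball 0 1" for z
    using f(2) that assms(2) by (simp add: sqnorm_def g_def norm_mult power_mult_distrib sum_distrib_left)
  ultimately show ?thesis
    by (auto simp: in_P_infinity_def)
qed

lemma in_P_infinity_add:
  assumes "in_P_infinity R" "in_P_infinity R'"
  shows "in_P_infinity (\<lambda>z. R z + R' z)"
proof -
  obtain M f M' f' where f: "holomorphic_map M f" "\<forall>z\<in>ball 0 1. R z = sqnorm M f z"
    and f': "holomorphic_map M' f'" "\<forall>z\<in>ball 0 1. R' z = sqnorm M' f' z"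
    using assms by (auto simp: in_P_infinity_def)
  define g where "g z i = (if i < M then f z i else f' z (i - M))" for z i
  have "holomorphic_map (M + M') g"
    unfolding holomorphic_map_def
  proof (intro allI impI)
    fix i assume "i < M + M'"
    then show "holomorphic_several (\<lambda>z. g z i) (ball 0 1)"
      using f(1) f'(1) unfolding holomorphic_map_def g_def by (cases "i < M") auto
  qed
  moreover have "sum h {..<M + M'} = sum h {..<M} + (\<Sum>i<M'. h (M + i))" for h :: "nat \<Rightarrow> real"
    by (induction M') (auto simp: add.assoc)
  then have "R z + R' z = sqnorm (M + M') g z" if "z \<in> ball 0 1" for z
    using f(2) f'(2) that by (simp add: sqnorm_def g_def)
  ultimately show ?thesis
    by (auto simp: in_P_infinity_def)
qed

lemma lookup_scaleR: "Poly_Mapping.lookup (a *\<^sub>R x) i = a *\<^sub>R Poly_Mapping.lookup x i"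
proof -
  have "finite {i. a *\<^sub>R Poly_Mapping.lookup x i \<noteq> 0}"
    by (rule finite_subset[OF _ finite_keys[of x]]) (auto simp: in_keys_iff)
  then show ?thesis
    by (simp add: scaleR_poly_mapping_def lookup_Abs_poly_mapping)
qed

lemma family_norm_affine:
  assumes "a + b = 1"
  shows "family_norm k Ns fs (a *\<^sub>R x + b *\<^sub>R y) z = a * family_norm k Ns fs x z + b * family_norm k Ns fs y z"
proof -
  define q where "q j = sqnorm (Ns j) (fs j) z" for j
  define X where "X j = Poly_Mapping.lookup x j" for j
  define Y where "Y j = Poly_Mapping.lookup y j" for j
  have A: "(\<Sum>j<k. (a * X j + b * Y j) * q j) = a * (\<Sum>j<k. X j * q j) + b * (\<Sum>j<k. Y j * q j)"
    by (simp add: distrib_right sum.distrib sum_distrib_left mult.assoc)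
  have B: "1 - (\<Sum>j<k. a * X j + b * Y j) = a * (1 - (\<Sum>j<k. X j)) + b * (1 - (\<Sum>j<k. Y j))"
    using assms by (simp add: sum.distrib sum_distrib_left right_diff_distrib)
  show ?thesis
    unfolding family_norm_def lookup_add lookup_scaleR real_scaleR_def
      X_def[symmetric] Y_def[symmetric] q_def[symmetric] A B
    by (simp add: algebra_simps)
qed

lemma convex_param_space: "convex (param_space k)"
proof (rule convexI)
  fix x y :: "nat \<Rightarrow>\<^sub>0 real" and a b :: real
  assume *: "x \<in> param_space k" "y \<in> param_space k"
  show "a *\<^sub>R x + b *\<^sub>R y \<in> param_space k"
    unfolding param_space_def
  proof (intro CollectI subsetI)
    fix i assume "i \<in> Poly_Mapping.keys (a *\<^sub>R x + b *\<^sub>R y)"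
    then have "Poly_Mapping.lookup x i \<noteq> 0 \<or> Poly_Mapping.lookup y i \<noteq> 0"
      by (auto simp: in_keys_iff lookup_add lookup_scaleR)
    then show "i \<in> {..<k}"
      using * unfolding param_space_def by (auto simp flip: in_keys_iff)
  qed
qed

text \<open>
  Direct sums and scaling show that the functions in \<open>\<P>\<^sub>\<infinity>\<close> form a
  convex cone. So the set of all admissible parameters is itself convex, and therefore the greatest
  convex one.
\<close>

lemma family_params_eq:
  "family_params k Ns fs = {l \<in> param_space k. in_P_infinity (family_norm k Ns fs l)}" (is "_ = ?K")
  unfolding family_params_def
proof (rule Greatest_equality)
  have "convex ?K"
  proof (rule convexI)
    fix x y and a b :: real
    assume *: "x \<in> ?K" "y \<in> ?K" "0 \<le> a" "0 \<le> b" "a + b = 1"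
    then have "in_P_infinity (\<lambda>z. a * family_norm k Ns fs x z + b * family_norm k Ns fs y z)"
      by (intro in_P_infinity_add in_P_infinity_scale) auto
    moreover have "family_norm k Ns fs (a *\<^sub>R x + b *\<^sub>R y) =
        (\<lambda>z. a * family_norm k Ns fs x z + b * family_norm k Ns fs y z)"
      by (intro ext family_norm_affine *(5))
    moreover have "a *\<^sub>R x + b *\<^sub>R y \<in> param_space k"
      using * convexD[OF convex_param_space, of x k y a b] by simp
    ultimately show "a *\<^sub>R x + b *\<^sub>R y \<in> ?K" by simp
  qed
  then show "?K \<subseteq> param_space k \<and> convex ?K \<and> (\<forall>l\<in>?K. in_P_infinity (family_norm k Ns fs l))"
    by auto
qed auto

lemma has_hermitian_form_sum:
  assumes "finite J" "\<And>j. j \<in> J \<Longrightarrow> has_hermitian_form (R j) (c j)"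
  shows "has_hermitian_form (\<lambda>z. \<Sum>j\<in>J. a j * R j z) (\<lambda>\<alpha> \<beta>. \<Sum>j\<in>J. complex_of_real (a j) * c j \<alpha> \<beta>)"
  using assms
proof (induction rule: finite_induct)
  case empty
  then show ?case by (auto simp: has_hermitian_form_def case_prod_unfold intro!: exI[of _ 1])
next
  case (insert j J)
  then have "has_hermitian_form (\<lambda>z. \<Sum>j\<in>J. a j * R j z) (\<lambda>\<alpha> \<beta>. \<Sum>j\<in>J. complex_of_real (a j) * c j \<alpha> \<beta>)"
    by blast
  then obtain r where r: "r > 0" "\<And>z. z \<in> ball 0 r \<Longrightarrow>
      ((\<lambda>(\<alpha>, \<beta>). (\<Sum>j\<in>J. complex_of_real (a j) * c j \<alpha> \<beta>) * monom_val z \<alpha> * cnj (monom_val z \<beta>))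
        has_sum complex_of_real (\<Sum>j\<in>J. a j * R j z)) UNIV"
    unfolding has_hermitian_form_def by blast
  from insert.prems[of j] obtain s where s: "s > 0" "\<And>z. z \<in> ball 0 s \<Longrightarrow>
      ((\<lambda>(\<alpha>, \<beta>). c j \<alpha> \<beta> * monom_val z \<alpha> * cnj (monom_val z \<beta>)) has_sum complex_of_real (R j z)) UNIV"
    unfolding has_hermitian_form_def by blast
  have "((\<lambda>(\<alpha>, \<beta>). (\<Sum>j\<in>insert j J. complex_of_real (a j) * c j \<alpha> \<beta>) * monom_val z \<alpha> * cnj (monom_val z \<beta>))
      has_sum complex_of_real (\<Sum>j\<in>insert j J. a j * R j z)) UNIV" if "z \<in> ball 0 (min r s)" for z
    using has_sum_add[OF has_sum_cmult_right[OF s(2)[of z], of "complex_of_real (a j)"] r(2)[of z]] that insert.hyps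
    by (simp add: case_prod_unfold algebra_simps)
  then show ?case
    unfolding has_hermitian_form_def using r(1) s(1) by (intro exI[of _ "min r s"]) simp
qed

lemma monomial_family_sphere_form:
  assumes "monomial_family N \<F>" "(M, f) \<in> \<F>"
  obtains p where "sphere_form p" "card {\<alpha>. p \<alpha> \<noteq> 0} \<le> N"
    "\<And>z. z \<in> ball 0 1 \<Longrightarrow> sqnorm M f z = diag_form p z"
proof -
  obtain g where g: "monomial_proper_map N g" "norm_equivalent M f N g"
    using assms by (auto simp: monomial_family_def)
  obtain p where "sphere_form p" "card {\<alpha>. p \<alpha> \<noteq> 0} \<le> N"
    "\<And>z. z \<in> ball 0 1 \<Longrightarrow> sqnorm N g z = diag_form p z"
    using monomial_proper_map_sphere_form[OF g(1)] by blast
  with g(2) show ?thesis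
    by (intro that[of p]) (auto simp: norm_equivalent_def)
qed

lemma sphere_form_top_exponent:
  assumes "sphere_form p"
  obtains \<alpha>0 where "p \<alpha>0 > 0" "\<alpha>0 \<noteq> (\<lambda>_. 0)" "\<And>\<alpha>. p \<alpha> \<noteq> 0 \<Longrightarrow> sum \<alpha> UNIV \<le> sum \<alpha>0 UNIV"
proof -
  define S where "S = {\<alpha>. p \<alpha> \<noteq> 0}"
  have S: "finite S" and nonneg: "\<And>\<alpha>. p \<alpha> \<ge> 0"
    using assms by (auto simp: sphere_form_def S_def)
  obtain \<alpha>1 where \<alpha>1: "\<alpha>1 \<noteq> (\<lambda>_. 0)" "\<alpha>1 \<in> S"
    using assms by (auto simp: sphere_form_def S_def)
  define d where "d = Max ((\<lambda>\<alpha>. sum \<alpha> UNIV) ` S)"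
  have le: "sum \<alpha> UNIV \<le> d" if "\<alpha> \<in> S" for \<alpha>
    using S that by (simp add: d_def)
  have "d \<in> (\<lambda>\<alpha>. sum \<alpha> UNIV) ` S"
    unfolding d_def using S \<alpha>1(2) by (intro Max_in) auto
  then obtain \<alpha>0 where \<alpha>0: "\<alpha>0 \<in> S" "d = sum \<alpha>0 UNIV"
    by blast
  have "\<alpha>0 \<noteq> (\<lambda>_. 0)"
  proof
    assume "\<alpha>0 = (\<lambda>_. 0)"
    then have "sum \<alpha>1 UNIV = 0" using le[OF \<alpha>1(2)] \<alpha>0(2) by simp
    with \<alpha>1(1) show False by (auto simp: fun_eq_iff)
  qed
  moreover have "p \<alpha>0 > 0"
    using \<alpha>0(1) nonneg[of \<alpha>0] by (simp add: S_def)
  ultimately show ?thesis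
    using le \<alpha>0(2) by (intro that[of \<alpha>0]) (auto simp: S_def)
qed

text \<open>
  The generators of a family correspond to the unit vectors and the origin of the parameter space.
\<close>

lemma family_vertex_norm:
  assumes "j \<le> k"
  obtains l where "l \<in> param_space k" "\<And>z. family_norm k Ns fs l z = sqnorm (Ns j) (fs j) z"
proof (cases "j < k")
  case True
  define l :: "nat \<Rightarrow>\<^sub>0 real" where "l = Poly_Mapping.single j 1"
  have lookup: "Poly_Mapping.lookup l i = (if i = j then 1 else 0)" for i
    by (simp add: l_def lookup_single when_def)
  have "family_norm k Ns fs l z = sqnorm (Ns j) (fs j) z" for z
    using True by (simp add: family_norm_def lookup if_distrib[of "\<lambda>x. x * _"] cong: if_cong)
  moreover have "l \<in> param_space k"
    using True by (simp add: param_space_def l_def)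
  ultimately show ?thesis by (rule that[rotated])
next
  case False
  with assms have "j = k" by simp
  then show ?thesis
    by (intro that[of 0]) (simp_all add: param_space_def family_norm_def)
qed

text \<open>
  In terms of coefficients, the family lies in an affine space of dimension \<open>k\<close>, spanned by
  the coefficient families of the generators, all of which are supported in a set \<open>T\<close>.
  The barycentre of the generators has support exactly \<open>T\<close> and is again a member, so
  \<open>T\<close> has at most \<open>N\<close> elements. Going from \<open>p\<close> to a vertex
  removes at least \<open>k\<close> of them and can be done without losing \<open>\<alpha>0\<close>.
\<close>

lemma convex_family_sparse_map:
  fixes \<F> :: "(nat \<times> 'n::finite cmap) set"
  assumes k: "k > 0" and \<F>: "convex_family k \<F>" and mono: "monomial_family N \<F>" and f: "(M, f) \<in> \<F>"
    and p: "sphere_form p" "\<And>z. z \<in> ball 0 1 \<Longrightarrow> sqnorm M f z = diag_form p z"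
    and \<alpha>0: "p \<alpha>0 > 0" "\<alpha>0 \<noteq> (\<lambda>_. 0)"
  obtains q where "sphere_form q" "card {\<alpha>. q \<alpha> \<noteq> 0} \<le> N - k" "q \<alpha>0 > 0"
proof -
  obtain Ns fs where proper: "\<And>j. j \<le> k \<Longrightarrow> proper_holomorphic_map (Ns j) (fs j)"
    and indep: "independent_hermitian_forms (Suc k) (\<lambda>j. sqnorm (Ns j) (fs j))"
    and \<F>_eq: "\<F> = {(M, g). proper_holomorphic_map M g \<and>
      (\<exists>l\<in>family_params k Ns fs. \<forall>z\<in>ball 0 1. sqnorm M g z = family_norm k Ns fs l z)}"
    using \<F> k unfolding convex_family_def by (simp split: if_splits) blast
  have member: "(M', g) \<in> \<F>"
    if "proper_holomorphic_map M' g" "l \<in> param_space k"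
      "\<And>z. z \<in> ball 0 1 \<Longrightarrow> sqnorm M' g z = family_norm k Ns fs l z" for M' g l
  proof -
    have "in_P_infinity (family_norm k Ns fs l)"
      using that unfolding in_P_infinity_def proper_holomorphic_map_def by metis
    with that show ?thesis
      by (auto simp: \<F>_eq family_params_eq)
  qed
  have "\<exists>pj. sphere_form pj \<and> (\<forall>z\<in>ball 0 1. sqnorm (Ns j) (fs j) z = diag_form pj z)" if j: "j \<le> k" for j
  proof -
    obtain l where "l \<in> param_space k" "\<And>z. family_norm k Ns fs l z = sqnorm (Ns j) (fs j) z"
      using family_vertex_norm[OF j] by blast
    then have "(Ns j, fs j) \<in> \<F>"
      using proper[OF j] by (intro member) auto
    then show ?thesis
      using monomial_family_sphere_form[OF mono] by metis
  qed
  then obtain P where P: "\<And>j. j \<le> k \<Longrightarrow> sphere_form (P j)"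
    and P_eq: "\<And>j z. j \<le> k \<Longrightarrow> z \<in> ball 0 1 \<Longrightarrow> sqnorm (Ns j) (fs j) z = diag_form (P j) z"
    by metis
  have P_nonneg: "P j \<alpha> \<ge> 0" if "j \<le> k" for j \<alpha>
    using P[OF that] by (simp add: sphere_form_def)
  define T where "T = (\<Union>j\<le>k. {\<alpha>. P j \<alpha> \<noteq> 0})"
  have finT: "finite T"
    using P by (auto simp: T_def sphere_form_def)
  have P_T: "P j \<alpha> = 0" if "j \<le> k" "\<alpha> \<notin> T" for j \<alpha>
    using that by (auto simp: T_def)
  define comb where "comb l \<alpha> = (\<Sum>j<k. Poly_Mapping.lookup l j * P j \<alpha>) +
      (1 - (\<Sum>j<k. Poly_Mapping.lookup l j)) * P k \<alpha>" for l \<alpha>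
  have comb_T: "comb l \<alpha> = 0" if "\<alpha> \<notin> T" for l \<alpha>
    using P_T that by (simp add: comb_def)
  have fin_comb: "finite {\<alpha>. comb l \<alpha> \<noteq> 0}" for l
    by (rule finite_subset[OF _ finT]) (use comb_T in auto)
  have P_diag: "diag_form (P j) z = (\<Sum>\<alpha>\<in>T. P j \<alpha> * (cmod (monom_val z \<alpha>))\<^sup>2)" if "j \<le> k" for j z
    using that P_T by (intro diag_form_superset finT)
  have comb_diag: "diag_form (comb l) z = (\<Sum>j<k. Poly_Mapping.lookup l j * diag_form (P j) z) +
      (1 - (\<Sum>j<k. Poly_Mapping.lookup l j)) * diag_form (P k) z" for l z
  proof -
    have "diag_form (comb l) z = (\<Sum>\<alpha>\<in>T. comb l \<alpha> * (cmod (monom_val z \<alpha>))\<^sup>2)"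
      using comb_T by (intro diag_form_superset finT)
    also have "\<dots> = (\<Sum>j<k. Poly_Mapping.lookup l j * (\<Sum>\<alpha>\<in>T. P j \<alpha> * (cmod (monom_val z \<alpha>))\<^sup>2)) +
      (1 - (\<Sum>j<k. Poly_Mapping.lookup l j)) * (\<Sum>\<alpha>\<in>T. P k \<alpha> * (cmod (monom_val z \<alpha>))\<^sup>2)"
      unfolding comb_def distrib_right sum.distrib sum_distrib_right sum_distrib_left[of _ _ T]
      by (subst sum.swap) (simp add: mult.assoc sum_distrib_left)
    finally show ?thesis by (simp add: P_diag)
  qed
  have family_norm_diag: "family_norm k Ns fs l z = diag_form (comb l) z" if "z \<in> ball 0 1" for l z
    using P_eq that by (simp add: family_norm_def comb_diag)
  have comb_sphere: "diag_form (comb l) z = 1" if "norm z = 1" for l z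
    using P that by (simp add: comb_diag sphere_form_def)

  \<comment> \<open>The member with all weights equal to \<open>1 / (k + 1)\<close> has every monomial of \<open>T\<close> in its squared norm.\<close>
  have card_T: "card T \<le> N"
  proof -
    define c where "c = 1 / real (Suc k)"
    define l where "l = (\<Sum>j<k. Poly_Mapping.single j c)"
    have lookup: "Poly_Mapping.lookup l j = (if j < k then c else 0)" for j
      by (simp add: l_def lookup_sum lookup_single when_def)
    have "(1 - real k * c) = c"
      by (simp add: c_def field_simps)
    then have comb_l: "comb l \<alpha> = c * (\<Sum>j\<le>k. P j \<alpha>)" for \<alpha>
      by (simp add: comb_def lookup lessThan_Suc_atMost[symmetric] distrib_left sum_distrib_left)
    have "c > 0" by (simp add: c_def)
    then have nonneg: "comb l \<alpha> \<ge> 0" for \<alpha>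
      using P_nonneg unfolding comb_l by (intro mult_nonneg_nonneg sum_nonneg) auto
    have "(\<Sum>j\<le>k. P j \<alpha>) = 0 \<longleftrightarrow> (\<forall>j\<le>k. P j \<alpha> = 0)" for \<alpha>
      using sum_nonneg_eq_0_iff[of "{..k}" "\<lambda>j. P j \<alpha>"] P_nonneg by auto
    then have supp: "{\<alpha>. comb l \<alpha> \<noteq> 0} = T"
      using \<open>c > 0\<close> by (auto simp: comb_l T_def)
    have "\<exists>\<alpha>. \<alpha> \<noteq> (\<lambda>_. 0) \<and> P k \<alpha> \<noteq> 0"
      using P[of k] by (simp add: sphere_form_def)
    then have "\<exists>\<alpha>. \<alpha> \<noteq> (\<lambda>_. 0) \<and> comb l \<alpha> \<noteq> 0"
      using supp by (auto simp: T_def)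
    then have form: "sphere_form (comb l)"
      using nonneg fin_comb comb_sphere by (simp add: sphere_form_def)
    have "card {\<alpha>. comb l \<alpha> \<noteq> 0} \<le> card T"
      by (simp add: supp)
    then obtain h where h: "monomial_proper_map (card T) h" "\<And>z. sqnorm (card T) h z = diag_form (comb l) z"
      using sphere_form_monomial_proper_map[OF form] by metis
    have "l \<in> param_space k"
      by (auto simp: param_space_def in_keys_iff lookup split: if_splits)
    then have "(card T, h) \<in> \<F>"
      using h by (intro member[of _ _ l]) (auto simp: monomial_proper_map_def family_norm_diag)
    then obtain p' where p': "sphere_form p'" "card {\<alpha>. p' \<alpha> \<noteq> 0} \<le> N"
      "\<And>z. z \<in> ball 0 1 \<Longrightarrow> sqnorm (card T) h z = diag_form p' z"
      using monomial_family_sphere_form[OF mono] by metis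
    have "p' = comb l"
      using p' h(2) fin_comb by (intro diag_form_inject) (auto simp: sphere_form_def)
    then show ?thesis using p'(2) supp by simp
  qed

  have p_T: "p \<alpha> = 0" if "\<alpha> \<notin> T" for \<alpha>
  proof -
    obtain l where l: "\<forall>z\<in>ball 0 1. sqnorm M f z = family_norm k Ns fs l z"
      using f by (auto simp: \<F>_eq)
    have "p = comb l"
      using p l fin_comb family_norm_diag by (intro diag_form_inject) (auto simp: sphere_form_def)
    then show ?thesis using comb_T that by simp
  qed

  define b where "b j \<alpha> = P j \<alpha> - P k \<alpha>" for j \<alpha>
  have b_indep: "\<forall>j<k. a j = 0" if zero: "\<And>\<alpha>. (\<Sum>j<k. a j * b j \<alpha>) = 0" for a
  proof -
    obtain c where c: "\<And>j. j < Suc k \<Longrightarrow> has_hermitian_form (sqnorm (Ns j) (fs j)) (c j)"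
      "\<And>a :: nat \<Rightarrow> real. (\<forall>\<alpha> \<beta>. (\<Sum>j<Suc k. complex_of_real (a j) * c j \<alpha> \<beta>) = 0) \<Longrightarrow> (\<forall>j<Suc k. a j = 0)"
      using indep unfolding independent_hermitian_forms_def by blast
    \<comment> \<open>A relation between the differences is a relation between all \<open>k + 1\<close> generators with coefficient sum \<open>0\<close>.\<close>
    define a' where "a' j = (if j = k then - (\<Sum>j<k. a j) else a j)" for j
    have a'_P: "(\<Sum>j<Suc k. a' j * P j \<alpha>) = 0" for \<alpha>
      using zero[of \<alpha>] by (simp add: a'_def b_def right_diff_distrib sum_subtractf sum_distrib_right)
    have "(\<Sum>j<Suc k. a' j * sqnorm (Ns j) (fs j) z) = 0" if z: "z \<in> ball 0 1" for z
    proof -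
      have "(\<Sum>j<Suc k. a' j * sqnorm (Ns j) (fs j) z) = (\<Sum>j<Suc k. \<Sum>\<alpha>\<in>T. a' j * P j \<alpha> * (cmod (monom_val z \<alpha>))\<^sup>2)"
        using z by (intro sum.cong) (auto simp: P_eq P_diag sum_distrib_left mult.assoc)
      also have "\<dots> = (\<Sum>\<alpha>\<in>T. (\<Sum>j<Suc k. a' j * P j \<alpha>) * (cmod (monom_val z \<alpha>))\<^sup>2)"
        unfolding sum_distrib_right by (rule sum.swap)
      also have "\<dots> = 0" by (simp only: a'_P) simp
      finally show ?thesis .
    qed
    moreover have "has_hermitian_form (\<lambda>z. \<Sum>j<Suc k. a' j * sqnorm (Ns j) (fs j) z)
        (\<lambda>\<alpha> \<beta>. \<Sum>j<Suc k. complex_of_real (a' j) * c j \<alpha> \<beta>)"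
      using c(1) by (intro has_hermitian_form_sum) auto
    ultimately have "(\<Sum>j<Suc k. complex_of_real (a' j) * c j \<alpha> \<beta>) = 0" for \<alpha> \<beta>
      using hermitian_form_of_zero[of _ _ 1] by fastforce
    then have "\<forall>j<Suc k. a' j = 0" using c(2) by blast
    then show ?thesis by (auto simp: a'_def dest: less_SucI)
  qed
  obtain u :: "complex ^ 'n" where u: "norm u = 1" "\<And>\<alpha>. monom_val u \<alpha> \<noteq> 0"
    using generic_unit_vector by blast
  have "\<exists>q. (\<forall>\<alpha>. q \<alpha> \<ge> 0) \<and> (\<forall>\<alpha>. \<alpha> \<notin> T \<longrightarrow> q \<alpha> = 0) \<and> q \<alpha>0 > 0 \<and>
    (\<forall>z\<in>{z. norm z = 1}. (\<Sum>\<alpha>\<in>T. q \<alpha> * (cmod (monom_val z \<alpha>))\<^sup>2) = (\<Sum>\<alpha>\<in>T. p \<alpha> * (cmod (monom_val z \<alpha>))\<^sup>2)) \<and>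
    card {\<alpha>. q \<alpha> \<noteq> 0} + k \<le> card T"
  proof (rule sparse_nonneg_point[where b = b and ?z0.0 = u])
    fix j and z :: "complex ^ 'n" assume "j < k" "z \<in> {z. norm z = 1}"
    then show "(\<Sum>\<alpha>\<in>T. b j \<alpha> * (cmod (monom_val z \<alpha>))\<^sup>2) = 0"
      using P[of j] P[of k] P_diag[of j z] P_diag[of k z]
      by (simp add: b_def left_diff_distrib sum_subtractf sphere_form_def)
  next
    fix j \<alpha> assume "j < k" "\<alpha> \<notin> T"
    then show "b j \<alpha> = 0" using P_T by (simp add: b_def)
  qed (use finT b_indep u p_T \<alpha>0 p in \<open>auto simp: sphere_form_def\<close>)
  then obtain q where q: "\<And>\<alpha>. q \<alpha> \<ge> 0" "\<And>\<alpha>. \<alpha> \<notin> T \<Longrightarrow> q \<alpha> = 0" "q \<alpha>0 > 0"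
    "\<And>z. norm z = 1 \<Longrightarrow> (\<Sum>\<alpha>\<in>T. q \<alpha> * (cmod (monom_val z \<alpha>))\<^sup>2) = (\<Sum>\<alpha>\<in>T. p \<alpha> * (cmod (monom_val z \<alpha>))\<^sup>2)"
    "card {\<alpha>. q \<alpha> \<noteq> 0} + k \<le> card T"
    by auto
  have "diag_form q z = 1" if "norm z = 1" for z
    using p(1) that q(2,4) p_T by (simp add: sphere_form_def diag_form_superset[OF finT])
  moreover have "finite {\<alpha>. q \<alpha> \<noteq> 0}"
    by (rule finite_subset[OF _ finT]) (use q(2) in auto)
  moreover have "\<exists>\<alpha>. \<alpha> \<noteq> (\<lambda>_. 0) \<and> q \<alpha> \<noteq> 0"
    using \<alpha>0(2) q(3) by (intro exI[of _ \<alpha>0]) auto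
  ultimately have "sphere_form q"
    using q(1) by (simp add: sphere_form_def)
  then show ?thesis
    using q(3,5) card_T by (intro that[of q]) auto
qed

theorem theorem3:
  fixes \<F> :: "(nat \<times> 'n::finite cmap) set"
    and c :: "nat \<Rightarrow> nat \<Rightarrow> real"
    and k N :: nat
  assumes "CARD('n) \<ge> 2"
    and "convex_family k \<F>"
    and "monomial_family N \<F>"
    and "\<And>M (g :: 'n cmap). monomial_proper_map M g \<Longrightarrow> real (map_degree M g) \<le> c CARD('n) M"
  shows "\<forall>(M, f)\<in>\<F>. real (map_degree M f) \<le> c CARD('n) (N - k)"
proof safe
  fix M and f :: "'n cmap" assume f: "(M, f) \<in> \<F>"
  obtain p where p: "sphere_form p" "card {\<alpha>. p \<alpha> \<noteq> 0} \<le> N"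
    "\<And>z. z \<in> ball 0 1 \<Longrightarrow> sqnorm M f z = diag_form p z"
    using monomial_family_sphere_form[OF assms(3) f] by blast
  obtain \<alpha>0 where \<alpha>0: "p \<alpha>0 > 0" "\<alpha>0 \<noteq> (\<lambda>_. 0)" "\<And>\<alpha>. p \<alpha> \<noteq> 0 \<Longrightarrow> sum \<alpha> UNIV \<le> sum \<alpha>0 UNIV"
    using sphere_form_top_exponent[OF p(1)] by blast
  have "holomorphic_map M f"
    using f assms(2) by (auto simp: convex_family_def proper_holomorphic_map_def split: if_splits)
  then have deg_f: "map_degree M f \<le> sum \<alpha>0 UNIV"
    using p \<alpha>0(3) by (intro map_degree_le[of _ _ p]) (auto simp: sphere_form_def)
  obtain q where q: "sphere_form q" "card {\<alpha>. q \<alpha> \<noteq> 0} \<le> N - k" "q \<alpha>0 > 0"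
  proof (cases "k = 0")
    case True
    then show ?thesis using that p \<alpha>0 by simp
  next
    case False
    then show ?thesis
      using convex_family_sparse_map[OF _ assms(2,3) f p(1,3) \<alpha>0(1,2)] that by blast
  qed
  obtain h :: "'n cmap" where h: "monomial_proper_map (N - k) h"
    "\<forall>\<alpha>. q \<alpha> \<noteq> 0 \<longrightarrow> sum \<alpha> UNIV \<le> map_degree (N - k) h"
    using sphere_form_monomial_proper_map[OF q(1,2)] by metis
  have "map_degree M f \<le> map_degree (N - k) h"
    using deg_f spec[OF h(2), of \<alpha>0] q(3) by linarith
  then show "real (map_degree M f) \<le> c CARD('n) (N - k)"
    using assms(4)[OF h(1)] by linarith
qed

end
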